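(* Consider the stochastic partial differential equation $$dU=(p\,\mathrm{Id}+\partial_{xx})U\,dt+dW$$ on $L^2(\mathbb{R})$, where $\partial_{xx}$ has domain the Sobolev space $H^2(\mathbb{R})$ and $W$ is a cylindrical Wiener process. Then $$\lim_{p\to 0^-}\Vert V_\infty\Vert_{B(L^2(\mathbb{R}))}=+\infty .$$
   Context: $p<0$ is a real parameter; $\Vert\cdot\Vert_{B(L^2(\mathbb{R}))}$ is the operator norm on linear operators induced by the $L^2(\mathbb{R})$-norm. The cylindrical Wiener process (space-time white noise) is the generalized Wiener process with covariance operator $Q=\mathrm{Id}$; the noise level is $\sigma=1$ and the noise operator is $B=\mathrm{Id}$. $V_\infty$ is the asymptotic covariance operator of the stochastic convolution $\int_0^t e^{(t-s)(p\,\mathrm{Id}+\partial_{xx})}\,dW_s$, i.e. $$V_\infty=\lim_{t\to\infty}\int_0^t e^{\tau A}e^{\tau A^*}\,d\tau=\int_0^\infty e^{2\tau(p\,\mathrm{Id}+\partial_{xx})}\,d\tau,\qquad A=p\,\mathrm{Id}+\partial_{xx}.$$ *)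

theory Defs
  imports "HOL-Analysis.Analysis"
begin

section \<open>The Hilbert space of real square-integrable functions on the line\<close>

definition square_integrable :: "(real \<Rightarrow> real) \<Rightarrow> bool" where
  "square_integrable f \<longleftrightarrow> f \<in> borel_measurable lborel \<and> integrable lborel (\<lambda>x. (f x)\<^sup>2)"

lemma square_integrable_mult:
  assumes "square_integrable f" "square_integrable g"
  shows "integrable lborel (\<lambda>x. f x * g x)"
proof (rule Bochner_Integration.integrable_bound)
  show "integrable lborel (\<lambda>x. (f x)\<^sup>2 + (g x)\<^sup>2)"
    using assms by (auto simp: square_integrable_def)
  show "(\<lambda>x. f x * g x) \<in> borel_measurable lborel"
    using assms by (auto simp: square_integrable_def)
  have "norm (f x * g x) \<le> norm ((f x)\<^sup>2 + (g x)\<^sup>2)" for x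
  proof -
    have "2 * (\<bar>f x\<bar> * \<bar>g x\<bar>) \<le> (f x)\<^sup>2 + (g x)\<^sup>2"
      using zero_le_power2[of "\<bar>f x\<bar> - \<bar>g x\<bar>"] by (simp add: power2_diff)
    moreover have "0 \<le> \<bar>f x\<bar> * \<bar>g x\<bar>"
      by simp
    ultimately have "\<bar>f x\<bar> * \<bar>g x\<bar> \<le> (f x)\<^sup>2 + (g x)\<^sup>2"
      by linarith
    then show ?thesis
      by (simp add: abs_mult)
  qed
  then show "AE x in lborel. norm (f x * g x) \<le> norm ((f x)\<^sup>2 + (g x)\<^sup>2)"
    by simp
qed

lemma square_integrable_add:
  assumes "square_integrable f" "square_integrable g"
  shows "square_integrable (\<lambda>x. f x + g x)"
  using assms square_integrable_mult[OF assms]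
  by (auto simp: square_integrable_def power2_sum mult.assoc)

lemma square_integrable_scale: "square_integrable f \<Longrightarrow> square_integrable (\<lambda>x. c * f x)"
  by (auto simp: square_integrable_def power_mult_distrib)

lemma square_integrable_uminus: "square_integrable f \<Longrightarrow> square_integrable (\<lambda>x. - f x)"
  by (auto simp: square_integrable_def)

lemma square_integrable_diff:
  "square_integrable f \<Longrightarrow> square_integrable g \<Longrightarrow> square_integrable (\<lambda>x. f x - g x)"
  using square_integrable_add[of f "\<lambda>x. - g x"] square_integrable_uminus[of g] by simp

lemma square_integrable_zero: "square_integrable (\<lambda>x. 0)"
  by (simp add: square_integrable_def)

definition l2_rel :: "(real \<Rightarrow> real) \<Rightarrow> (real \<Rightarrow> real) \<Rightarrow> bool" where
  "l2_rel f g \<longleftrightarrow> square_integrable f \<and> square_integrable g \<and> (AE x in lborel. f x = g x)"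

quotient_type l2 = "real \<Rightarrow> real" / partial: l2_rel
proof (rule part_equivpI)
  show "\<exists>f. l2_rel f f"
    using square_integrable_zero by (auto simp: l2_rel_def)
  show "symp l2_rel"
    by (rule sympI) (auto simp: l2_rel_def)
  show "transp l2_rel"
    by (rule transpI) (auto simp: l2_rel_def elim: AE_mp)
qed

instantiation l2 :: real_vector
begin

lift_definition zero_l2 :: l2 is "\<lambda>x. 0"
  by (simp add: l2_rel_def square_integrable_zero)

lift_definition plus_l2 :: "l2 \<Rightarrow> l2 \<Rightarrow> l2" is "\<lambda>f g x. f x + g x"
  by (auto simp: l2_rel_def intro: square_integrable_add)

lift_definition uminus_l2 :: "l2 \<Rightarrow> l2" is "\<lambda>f x. - f x"
  by (auto simp: l2_rel_def intro: square_integrable_uminus)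

lift_definition minus_l2 :: "l2 \<Rightarrow> l2 \<Rightarrow> l2" is "\<lambda>f g x. f x - g x"
  by (auto simp: l2_rel_def intro: square_integrable_diff)

lift_definition scaleR_l2 :: "real \<Rightarrow> l2 \<Rightarrow> l2" is "\<lambda>c f x. c * f x"
  by (auto simp: l2_rel_def intro: square_integrable_scale)

instance
proof
  fix a b c :: l2 and r s :: real
  show "a + b + c = a + (b + c)"
    by transfer (auto simp: l2_rel_def add.assoc intro!: square_integrable_add)
  show "a + b = b + a"
    by transfer (auto simp: l2_rel_def add.commute intro!: square_integrable_add)
  show "0 + a = a"
    by transfer (auto simp: l2_rel_def)
  show "- a + a = 0"
    by transfer (auto simp: l2_rel_def square_integrable_zero)
  show "a - b = a + - b"
    by transfer (auto simp: l2_rel_def intro!: square_integrable_diff)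
  show "r *\<^sub>R (a + b) = r *\<^sub>R a + r *\<^sub>R b"
    by transfer (auto simp: l2_rel_def distrib_left
        intro!: square_integrable_add square_integrable_scale)
  show "(r + s) *\<^sub>R a = r *\<^sub>R a + s *\<^sub>R a"
    by transfer (auto simp: l2_rel_def distrib_right
        intro!: square_integrable_add square_integrable_scale)
  show "r *\<^sub>R s *\<^sub>R a = (r * s) *\<^sub>R a"
    by transfer (auto simp: l2_rel_def mult.assoc intro!: square_integrable_scale)
  show "1 *\<^sub>R a = a"
    by transfer (auto simp: l2_rel_def)
qed

end

instantiation l2 :: real_inner
begin

lift_definition inner_l2 :: "l2 \<Rightarrow> l2 \<Rightarrow> real" is "\<lambda>f g. \<integral>x. f x * g x \<partial>lborel"
  by (rule integral_cong_AE) (auto simp: l2_rel_def square_integrable_def elim: AE_mp)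

definition norm_l2 :: "l2 \<Rightarrow> real" where
  "norm_l2 f = sqrt (inner f f)"

definition sgn_l2 :: "l2 \<Rightarrow> l2" where
  "sgn_l2 f = f /\<^sub>R norm f"

definition dist_l2 :: "l2 \<Rightarrow> l2 \<Rightarrow> real" where
  "dist_l2 f g = norm (f - g)"

definition uniformity_l2 :: "(l2 \<times> l2) filter" where
  "uniformity_l2 = (INF e\<in>{0<..}. principal {(f, g). dist f g < e})"

definition open_l2 :: "l2 set \<Rightarrow> bool" where
  "open_l2 U \<longleftrightarrow> (\<forall>f\<in>U. eventually (\<lambda>(f', g). f' = f \<longrightarrow> g \<in> U) uniformity)"

instance
proof
  fix a b c :: l2 and r :: real and U :: "l2 set"
  show "sgn a = a /\<^sub>R norm a"
    by (rule sgn_l2_def)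
  show "dist a b = norm (a - b)"
    by (rule dist_l2_def)
  show "(uniformity :: (l2 \<times> l2) filter) = (INF e\<in>{0<..}. principal {(f, g). dist f g < e})"
    by (rule uniformity_l2_def)
  show "open U \<longleftrightarrow> (\<forall>f\<in>U. eventually (\<lambda>(f', g). f' = f \<longrightarrow> g \<in> U) uniformity)"
    by (rule open_l2_def)
  show "inner a b = inner b a"
    by transfer (simp add: mult.commute)
  show "inner (a + b) c = inner a c + inner b c"
    by transfer (auto simp: l2_rel_def distrib_right square_integrable_mult)
  show "inner (r *\<^sub>R a) b = r * inner a b"
    by transfer (simp add: mult.assoc)
  show "0 \<le> inner a a"
    by transfer (simp add: integral_nonneg_AE)
  show "inner a a = 0 \<longleftrightarrow> a = 0"
  proof transfer
    fix f :: "real \<Rightarrow> real"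
    assume f: "l2_rel f f"
    then have "integrable lborel (\<lambda>x. f x * f x)"
      by (auto simp: l2_rel_def square_integrable_mult)
    then have "(\<integral>x. f x * f x \<partial>lborel) = 0 \<longleftrightarrow> (AE x in lborel. f x * f x = 0)"
      by (rule integral_nonneg_eq_0_iff_AE) simp
    then show "(\<integral>x. f x * f x \<partial>lborel) = 0 \<longleftrightarrow> l2_rel f (\<lambda>x. 0)"
      using f by (simp add: l2_rel_def square_integrable_zero)
  qed
  show "norm a = sqrt (inner a a)"
    by (rule norm_l2_def)
qed

end


lemma norm_l2_sq: "l2_rel f f \<Longrightarrow> (norm (abs_l2 f))\<^sup>2 = (\<integral>x. (f x)\<^sup>2 \<partial>lborel)"
  by (simp only: power2_norm_eq_inner inner_l2.abs_eq) (simp add: power2_eq_square)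

lemma nn_integral_l2_sq:
  assumes "l2_rel f f"
  shows "(\<integral>\<^sup>+x. ennreal ((f x)\<^sup>2) \<partial>lborel) = ennreal ((norm (abs_l2 f))\<^sup>2)"
  unfolding norm_l2_sq[OF assms] using assms
  by (intro nn_integral_eq_integral) (auto simp: l2_rel_def square_integrable_def)

instance l2 :: complete_space
proof
  fix X :: "nat \<Rightarrow> l2"
  assume X: "Cauchy X"
  define F where "F n = rep_l2 (X n)" for n
  have F_rel: "l2_rel (F n) (F n)" for n
    unfolding F_def by (rule Quotient_rep_reflp[OF Quotient_l2])
  have abs_F: "abs_l2 (F n) = X n" for n
    unfolding F_def by (rule Quotient_abs_rep[OF Quotient_l2])
  have F_sq: "square_integrable (F n)" for n
    using F_rel by (simp add: l2_rel_def)
  have [measurable]: "F n \<in> borel_measurable lborel" for n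
    using F_sq by (simp add: square_integrable_def)
  have FF: "(\<integral>\<^sup>+x. ennreal ((F m x - F n x)\<^sup>2) \<partial>lborel) = ennreal ((norm (X m - X n))\<^sup>2)" for m n
    by (subst nn_integral_l2_sq)
      (auto simp: l2_rel_def F_sq square_integrable_diff F_rel minus_l2.abs_eq[symmetric] abs_F)
  have "\<exists>N. \<forall>m\<ge>N. \<forall>n\<ge>N. norm (X m - X n) < (1/2) ^ k" for k
    using CauchyD[OF X, of "(1/2) ^ k"] by simp
  then obtain N where N: "\<And>k m n. m \<ge> N k \<Longrightarrow> n \<ge> N k \<Longrightarrow> norm (X m - X n) < (1/2) ^ k"
    by metis
  define r where "r k = (\<Sum>i\<le>k. N i)" for k
  have r_ge: "r m \<ge> N k" if "k \<le> m" for k m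
    unfolding r_def using that by (intro member_le_sum) auto
  have r_dist: "norm (X (r m) - X (r n)) < (1/2) ^ k" if "k \<le> m" "k \<le> n" for k m n
    using that by (intro N r_ge)
  have "(\<integral>\<^sup>+x. (\<Sum>k. ennreal (2 ^ k * (F (r (Suc k)) x - F (r k) x)\<^sup>2)) \<partial>lborel)
      = (\<Sum>k. \<integral>\<^sup>+x. ennreal (2 ^ k * (F (r (Suc k)) x - F (r k) x)\<^sup>2) \<partial>lborel)"
    by (rule nn_integral_suminf) measurable
  also have "\<dots> = (\<Sum>k. ennreal (2 ^ k * (norm (X (r (Suc k)) - X (r k)))\<^sup>2))"
    by (simp add: ennreal_mult' nn_integral_cmult FF)
  also have "\<dots> \<le> (\<Sum>k. ennreal ((1/2) ^ k))"
  proof (intro suminf_le ennreal_leI)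
    fix k
    have "(norm (X (r (Suc k)) - X (r k)))\<^sup>2 \<le> ((1/2) ^ k)\<^sup>2"
      using r_dist[of k "Suc k" k] by (intro power_mono) auto
    then have "2 ^ k * (norm (X (r (Suc k)) - X (r k)))\<^sup>2 \<le> 2 ^ k * ((1/2) ^ k)\<^sup>2"
      by (intro mult_left_mono) auto
    also have "\<dots> = (1/2) ^ k"
      by (simp add: power2_eq_square power_one_over)
    finally show "2 ^ k * (norm (X (r (Suc k)) - X (r k)))\<^sup>2 \<le> (1/2) ^ k" .
  qed auto
  also have "\<dots> < \<infinity>"
    by (subst suminf_ennreal2) (auto intro: summable_geometric)
  finally have "AE x in lborel. (\<Sum>k. ennreal (2 ^ k * (F (r (Suc k)) x - F (r k) x)\<^sup>2)) \<noteq> \<infinity>"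
    by (intro nn_integral_noteq_infinite) auto
  then have conv: "AE x in lborel. convergent (\<lambda>k. F (r k) x)"
  proof (rule AE_mp, intro AE_I2 impI)
    fix x
    define d where "d k = F (r (Suc k)) x - F (r k) x" for k
    assume "(\<Sum>k. ennreal (2 ^ k * (F (r (Suc k)) x - F (r k) x)\<^sup>2)) \<noteq> \<infinity>"
    then have "summable (\<lambda>k. 2 ^ k * (d k)\<^sup>2)"
      unfolding d_def by (intro summable_suminf_not_top) auto
    moreover have "summable (\<lambda>k. (1/2 :: real) ^ k)"
      by (intro summable_geometric) auto
    ultimately have "summable (\<lambda>k. 2 ^ k * (d k)\<^sup>2 + (1/2) ^ k)"
      by (rule summable_add)
    moreover have "norm (d k) \<le> 2 ^ k * (d k)\<^sup>2 + (1/2) ^ k" for k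
    proof -
      have "0 \<le> (2 ^ k * \<bar>d k\<bar> - 1)\<^sup>2"
        by simp
      then have "2 ^ k * (2 * \<bar>d k\<bar>) \<le> 2 ^ k * (2 ^ k * (d k)\<^sup>2 + (1/2) ^ k)"
        by (simp add: power2_diff power_mult_distrib power2_eq_square[of "2 ^ k"] algebra_simps
            power_one_over)
      then have "2 * \<bar>d k\<bar> \<le> 2 ^ k * (d k)\<^sup>2 + (1/2) ^ k"
        by (rule mult_left_le_imp_le) simp
      then show ?thesis
        by simp
    qed
    ultimately have "summable d"
      by (rule summable_comparison_test'[where N = 0])
    then have "convergent (\<lambda>n. \<Sum>k<n. d k)"
      by (simp add: summable_iff_convergent)
    then have "convergent (\<lambda>n. F (r n) x - F (r 0) x)"
      unfolding d_def using sum_lessThan_telescope[of "\<lambda>k. F (r k) x"] by simp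
    then have "convergent (\<lambda>n. (F (r n) x - F (r 0) x) + F (r 0) x)"
      by (intro convergent_add convergent_const)
    then show "convergent (\<lambda>k. F (r k) x)"
      by simp
  qed
  define f where "f x = lim (\<lambda>k. F (r k) x)" for x
  have [measurable]: "f \<in> borel_measurable lborel"
    unfolding f_def by measurable
  have bound: "(\<integral>\<^sup>+x. ennreal ((F (r n) x - f x)\<^sup>2) \<partial>lborel) \<le> ennreal (((1/2) ^ n)\<^sup>2)" for n
  proof -
    have "(\<integral>\<^sup>+x. ennreal ((F (r n) x - f x)\<^sup>2) \<partial>lborel)
        = (\<integral>\<^sup>+x. liminf (\<lambda>k. ennreal ((F (r n) x - F (r k) x)\<^sup>2)) \<partial>lborel)"
    proof (rule nn_integral_cong_AE, rule AE_mp[OF conv], intro AE_I2 impI)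
      fix x
      assume "convergent (\<lambda>k. F (r k) x)"
      then have "(\<lambda>k. F (r k) x) \<longlonglongrightarrow> f x"
        by (simp add: f_def convergent_LIMSEQ_iff)
      then have "(\<lambda>k. ennreal ((F (r n) x - F (r k) x)\<^sup>2)) \<longlonglongrightarrow> ennreal ((F (r n) x - f x)\<^sup>2)"
        by (intro tendsto_intros)
      then show "ennreal ((F (r n) x - f x)\<^sup>2) = liminf (\<lambda>k. ennreal ((F (r n) x - F (r k) x)\<^sup>2))"
        by (intro lim_imp_Liminf[symmetric]) auto
    qed
    also have "\<dots> \<le> liminf (\<lambda>k. \<integral>\<^sup>+x. ennreal ((F (r n) x - F (r k) x)\<^sup>2) \<partial>lborel)"
      by (rule nn_integral_liminf) measurable
    also have "\<dots> = liminf (\<lambda>k. ennreal ((norm (X (r n) - X (r k)))\<^sup>2))"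
      by (simp add: FF)
    also have "\<dots> \<le> liminf (\<lambda>k. ennreal (((1/2) ^ n)\<^sup>2))"
    proof (rule Liminf_mono, rule eventually_mono[OF eventually_ge_at_top[of n]])
      fix k assume "n \<le> k"
      then show "ennreal ((norm (X (r n) - X (r k)))\<^sup>2) \<le> ennreal (((1/2) ^ n)\<^sup>2)"
        using r_dist[of n n k] by (intro ennreal_leI power_mono) auto
    qed
    also have "\<dots> = ennreal (((1/2) ^ n)\<^sup>2)"
      by (simp add: Liminf_const)
    finally show ?thesis .
  qed
  have diff_sq: "square_integrable (\<lambda>x. F (r n) x - f x)" for n
  proof -
    have "integrable lborel (\<lambda>x. (F (r n) x - f x)\<^sup>2)"
      using bound[of n] by (intro integrableI_bounded) (auto simp: le_less_trans)
    then show ?thesis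
      by (simp add: square_integrable_def)
  qed
  have f_sq: "square_integrable f"
    using square_integrable_diff[OF F_sq[of "r 0"] diff_sq[of 0]] by simp
  have "norm (X (r n) - abs_l2 f) \<le> (1/2) ^ n" for n
  proof -
    have "X (r n) - abs_l2 f = abs_l2 (\<lambda>x. F (r n) x - f x)"
      using minus_l2.abs_eq[of "F (r n)" f] F_sq f_sq by (simp add: l2_rel_def abs_F)
    then have "ennreal ((norm (X (r n) - abs_l2 f))\<^sup>2) \<le> ennreal (((1/2) ^ n)\<^sup>2)"
      using bound[of n] nn_integral_l2_sq[of "\<lambda>x. F (r n) x - f x"] diff_sq[of n]
      by (simp add: l2_rel_def)
    then have "(norm (X (r n) - abs_l2 f))\<^sup>2 \<le> ((1/2) ^ n)\<^sup>2"
      by (subst (asm) ennreal_le_iff) auto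
    then show ?thesis
      by (rule power2_le_imp_le) simp
  qed
  note rf = this
  have "X \<longlonglongrightarrow> abs_l2 f"
  proof (rule metric_LIMSEQ_I)
    fix e :: real
    assume "0 < e"
    then obtain k where k: "(1/2 :: real) ^ k < e / 2"
      using real_arch_pow_inv[of "e/2" "1/2"] by auto
    have "dist (X n) (abs_l2 f) < e" if "n \<ge> N k" for n
    proof -
      have "norm (X n - X (r k)) < (1/2) ^ k"
        using that r_ge[of k k] by (intro N) auto
      moreover have "norm (X n - abs_l2 f) \<le> norm (X n - X (r k)) + norm (X (r k) - abs_l2 f)"
        using norm_triangle_ineq[of "X n - X (r k)" "X (r k) - abs_l2 f"] by simp
      ultimately show ?thesis
        using rf[of k] k by (simp add: dist_norm)
    qed
    then show "\<exists>M. \<forall>n\<ge>M. dist (X n) (abs_l2 f) < e"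
      by blast
  qed
  then show "convergent X"
    by (rule convergentI)
qed


section \<open>The Laplacian on the Sobolev space of order two\<close>

definition test_function :: "(real \<Rightarrow> real) \<Rightarrow> bool" where
  "test_function \<phi> \<longleftrightarrow>
     (\<forall>n x. (deriv ^^ n) \<phi> field_differentiable at x) \<and> (\<exists>R. \<forall>x. R < \<bar>x\<bar> \<longrightarrow> \<phi> x = 0)"

lift_definition weak_derivative :: "nat \<Rightarrow> l2 \<Rightarrow> l2 \<Rightarrow> bool" is
  "\<lambda>k f g. \<forall>\<phi>. test_function \<phi> \<longrightarrow>
     (\<integral>x. f x * (deriv ^^ k) \<phi> x \<partial>lborel) = (-1) ^ k * (\<integral>x. g x * \<phi> x \<partial>lborel)"
proof -
  fix k :: nat and f f' g g' :: "real \<Rightarrow> real"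
  assume ff: "l2_rel f f'" and gg: "l2_rel g g'"
  have "(\<integral>x. f x * (deriv ^^ k) \<phi> x \<partial>lborel) = (\<integral>x. f' x * (deriv ^^ k) \<phi> x \<partial>lborel) \<and>
        (\<integral>x. g x * \<phi> x \<partial>lborel) = (\<integral>x. g' x * \<phi> x \<partial>lborel)" if "test_function \<phi>" for \<phi>
  proof -
    have *: "(deriv ^^ n) \<phi> \<in> borel_measurable lborel" for n
    proof -
      have "continuous_on UNIV ((deriv ^^ n) \<phi>)"
        using that
        by (auto simp: test_function_def
            intro!: continuous_at_imp_continuous_on field_differentiable_imp_continuous_at)
      then show ?thesis
        by (simp add: borel_measurable_continuous_onI)
    qed
    have 0: "\<phi> \<in> borel_measurable lborel"
      using *[of 0] by simp
    show ?thesis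
      using ff gg *[of k] 0
      by (auto simp: l2_rel_def square_integrable_def intro!: integral_cong_AE elim: AE_mp)
  qed
  then show "(\<forall>\<phi>. test_function \<phi> \<longrightarrow>
     (\<integral>x. f x * (deriv ^^ k) \<phi> x \<partial>lborel) = (-1) ^ k * (\<integral>x. g x * \<phi> x \<partial>lborel)) \<longleftrightarrow>
    (\<forall>\<phi>. test_function \<phi> \<longrightarrow>
     (\<integral>x. f' x * (deriv ^^ k) \<phi> x \<partial>lborel) = (-1) ^ k * (\<integral>x. g' x * \<phi> x \<partial>lborel))"
    by simp
qed

definition sobolev_H :: "nat \<Rightarrow> l2 set" where
  "sobolev_H k = {f. \<forall>j\<le>k. \<exists>g. weak_derivative j f g}"

text \<open>Unbounded linear operators are represented by their graphs.\<close>

definition laplacian :: "(l2 \<times> l2) set" where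
  "laplacian = {(f, g). f \<in> sobolev_H 2 \<and> weak_derivative 2 f g}"

definition drift_operator :: "real \<Rightarrow> (l2 \<times> l2) set" where
  "drift_operator p = {(f, p *\<^sub>R f + g) | f g. (f, g) \<in> laplacian}"


section \<open>Semigroups and the asymptotic covariance\<close>

text \<open>The values of a semigroup at negative times are irrelevant and left unconstrained.\<close>

definition c0_semigroup :: "(real \<Rightarrow> 'a::real_normed_vector \<Rightarrow> 'a) \<Rightarrow> bool" where
  "c0_semigroup S \<longleftrightarrow>
     (\<forall>t\<ge>0. bounded_linear (S t)) \<and>
     S 0 = id \<and>
     (\<forall>s\<ge>0. \<forall>t\<ge>0. S (s + t) = S s \<circ> S t) \<and>
     (\<forall>x. ((\<lambda>t. S t x) \<longlongrightarrow> x) (at_right 0))"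

definition generator :: "(real \<Rightarrow> 'a::real_normed_vector \<Rightarrow> 'a) \<Rightarrow> ('a \<times> 'a) set" where
  "generator S = {(x, y). ((\<lambda>t. (S t x - x) /\<^sub>R t) \<longlongrightarrow> y) (at_right 0)}"

text \<open>\<open>is_exp_semigroup A S\<close> says that \<open>S t\<close> is \<open>e\<^sup>t\<^sup>A\<close> for \<open>t \<ge> 0\<close>; on nonnegative times \<open>S\<close> is
  determined by \<open>A\<close>.\<close>

definition is_exp_semigroup ::
    "('a::real_normed_vector \<times> 'a) set \<Rightarrow> (real \<Rightarrow> 'a \<Rightarrow> 'a) \<Rightarrow> bool" where
  "is_exp_semigroup A S \<longleftrightarrow> c0_semigroup S \<and> generator S = A"

text \<open>The covariance operator at time \<open>t\<close> of the stochastic convolution of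
  \<open>dU = A U dt + \<sigma> B dW\<close>, where \<open>S\<close> is the semigroup generated by \<open>A\<close> and \<open>W\<close> is a (generalized)
  Wiener process with covariance operator \<open>Q\<close>:
  \<open>V\<^sub>t = \<sigma>\<^sup>2 \<integral>\<^sub>0\<^sup>t e\<^sup>\<tau>\<^sup>A B Q B\<^sup>* e\<^sup>\<tau>\<^sup>A\<^sup>* d\<tau>\<close>.
  Operator-valued integrals and limits are taken in the strong (pointwise) sense, as is usual for
  strongly continuous semigroups. A cylindrical Wiener process has \<open>Q = id\<close>.\<close>

definition covariance_operator ::
    "real \<Rightarrow> ('k::real_inner \<Rightarrow> 'h::real_inner) \<Rightarrow> ('k \<Rightarrow> 'k) \<Rightarrow> (real \<Rightarrow> 'h \<Rightarrow> 'h) \<Rightarrow> real \<Rightarrow> 'h \<Rightarrow> 'h" where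
  "covariance_operator \<sigma> B Q S t x =
     \<sigma>\<^sup>2 *\<^sub>R integral {0..t} (\<lambda>\<tau>. S \<tau> (B (Q (adjoint B (adjoint (S \<tau>) x)))))"

definition asymptotic_covariance ::
    "real \<Rightarrow> ('k::real_inner \<Rightarrow> 'h::real_inner) \<Rightarrow> ('k \<Rightarrow> 'k) \<Rightarrow> (real \<Rightarrow> 'h \<Rightarrow> 'h) \<Rightarrow> 'h \<Rightarrow> 'h" where
  "asymptotic_covariance \<sigma> B Q S x = Lim at_top (\<lambda>t. covariance_operator \<sigma> B Q S t x)"

end

theory Submission
  imports Defs
begin

text \<open>
  Write \<open>A = p Id + \<partial>\<^sub>x\<^sub>x\<close> and \<open>S t = e\<^sup>t\<^sup>A\<close>. The operator \<open>A\<close> is self-adjoint with \<open>A \<le> p < 0\<close>, so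
  \<open>V\<^sub>\<infinity> x = \<integral>\<^sub>0\<^sup>\<infinity> S (2 \<tau>) x d\<tau>\<close> converges, is bounded, and inverts \<open>-2 A\<close>: one has \<open>V\<^sub>\<infinity> (A f) = - f / 2\<close> on the
  domain of \<open>A\<close>. Hence \<open>\<parallel>f\<parallel> \<le> 2 \<parallel>V\<^sub>\<infinity>\<parallel> \<parallel>A f\<parallel>\<close>. Stretching a fixed test function, \<open>f x = \<phi> (c x)\<close> with
  \<open>c\<close> small, makes \<open>\<parallel>f''\<parallel> / \<parallel>f\<parallel>\<close>, which is proportional to \<open>c\<^sup>2\<close>, arbitrarily small, so that \<open>\<parallel>A f\<parallel>\<close>
  is at most about \<open>\<bar>p\<bar> \<parallel>f\<parallel>\<close>. This gives \<open>\<parallel>V\<^sub>\<infinity>\<parallel> \<ge> 1 / (2 \<bar>p\<bar>)\<close> (\<open>asymptotic_covariance_onorm_ge\<close>),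
  and the right-hand side tends to infinity as \<open>p\<close> increases to 0.

  The analytic core is that \<open>A\<close> is symmetric and bounded above by \<open>p\<close> on its whole domain,
  which consists of functions with weak derivatives. This comes down to integration by parts
  \<open>\<langle>u', v\<rangle> = - \<langle>u, v'\<rangle>\<close> for weakly differentiable \<open>u\<close> and \<open>v\<close>, hence to the density of test functions in
  the first Sobolev space. That density is extracted from the hypothesis that \<open>A\<close> generates a strongly
  continuous semigroup.
  \<^item> A generator is single-valued, so weak derivatives are unique, so no nonzero element of \<open>L\<^sup>2\<close> is
    orthogonal to all test functions (\<open>test_functions_total\<close>).
  \<^item> If \<open>f\<close> is orthogonal to all test functions in the equivalent Sobolev inner product
    \<open>r \<langle>f, \<phi>\<rangle> + \<langle>f', \<phi>'\<rangle>\<close>, then \<open>f'' = r f\<close> weakly. Thus \<open>f\<close> is an eigenvector of \<open>A\<close> for the eigenvalue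
    \<open>p + r\<close> and \<open>S 1 f = e\<^bsup>p + r\<^esup> f\<close>, which for large \<open>r\<close> contradicts boundedness of \<open>S 1\<close> unless \<open>f = 0\<close>.
  The projection theorem turns trivial orthogonal complements into density
  (\<open>weak_derivative_by_parts\<close>).

  The remaining ingredients are standard facts on semigroups: local boundedness (from the uniform
  boundedness principle), continuity and differentiability of orbits, and the passage from a
  symmetric generator bounded above by \<open>p\<close> to a self-adjoint semigroup with \<open>\<parallel>S t\<parallel> \<le> e\<^sup>p\<^sup>t\<close>.
\<close>

section \<open>Orthogonal projection and uniform boundedness\<close>

text \<open>The usual minimising-sequence argument: by the parallelogram law points of \<open>M\<close> almost closest to
  \<open>x\<close> form a Cauchy sequence, and a closest point makes the quadratic function
  \<open>t \<mapsto> \<parallel>x - y - t m\<parallel>\<^sup>2\<close> minimal at \<open>t = 0\<close>.\<close>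

lemma orthogonal_projection_exists:
  fixes M :: "'a::{real_inner, complete_space} set"
  assumes M: "subspace M" "closed M"
  obtains y where "y \<in> M" "\<And>m. m \<in> M \<Longrightarrow> inner (x - y) m = 0"
proof -
  define d where "d = infdist x M"
  have ne: "M \<noteq> {}" using M(1) subspace_0 by blast
  have d_le: "d \<le> norm (x - m)" if "m \<in> M" for m
    using infdist_le[OF that, of x] by (simp add: d_def dist_norm)
  have d0: "0 \<le> d" by (simp add: d_def infdist_nonneg)
  have "\<exists>m\<in>M. (norm (x - m))\<^sup>2 < d\<^sup>2 + e" if "e > 0" for e
  proof -
    have "d < sqrt (d\<^sup>2 + e)" using d0 that by (intro real_less_rsqrt) auto
    then obtain m where m: "m \<in> M" "norm (x - m) < sqrt (d\<^sup>2 + e)"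
      unfolding d_def infdist_notempty[OF ne] by (subst (asm) cINF_less_iff[OF ne bdd_below_image_dist]) (auto simp: dist_norm)
    then have "(norm (x - m))\<^sup>2 < (sqrt (d\<^sup>2 + e))\<^sup>2"
      by (intro power_strict_mono) auto
    then show ?thesis using m(1) that by auto
  qed
  then have "\<forall>n::nat. \<exists>m\<in>M. (norm (x - m))\<^sup>2 < d\<^sup>2 + inverse (real (Suc n))"
    by simp
  then obtain y where yM: "\<And>n. y n \<in> M"
    and y: "\<And>n. (norm (x - y n))\<^sup>2 < d\<^sup>2 + inverse (real (Suc n))"
    by metis
  have y': "(norm (x - y n))\<^sup>2 < d\<^sup>2 + inverse (real (Suc N))" if "N \<le> n" for n N
  proof -
    have "inverse (real (Suc n)) \<le> inverse (real (Suc N))"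
      using that by (intro le_imp_inverse_le) auto
    then show ?thesis using y[of n] by linarith
  qed
  have par: "(norm (y m - y n))\<^sup>2 < 4 * inverse (real (Suc N))" if "N \<le> m" "N \<le> n" for m n N
  proof -
    let ?z = "(1/2) *\<^sub>R (y m + y n)"
    have "?z \<in> M" using M(1) yM by (simp add: subspace_add subspace_scale)
    then have "d\<^sup>2 \<le> (norm (x - ?z))\<^sup>2" using d_le d0 by (intro power_mono) auto
    moreover have "(norm (y m - y n))\<^sup>2 + 4 * (norm (x - ?z))\<^sup>2
        = 2 * (norm (x - y m))\<^sup>2 + 2 * (norm (x - y n))\<^sup>2"
      by (simp add: power2_norm_eq_inner inner_simps inner_commute algebra_simps)
    ultimately show ?thesis using y'[OF that(1)] y'[OF that(2)] by linarith
  qed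
  have "Cauchy y"
  proof (rule CauchyI)
    fix e :: real assume e: "0 < e"
    then obtain N :: nat where N: "inverse (real (Suc N)) < e\<^sup>2 / 4"
      using reals_Archimedean[of "e\<^sup>2/4"] by auto
    have "norm (y m - y n) < e" if "N \<le> m" "N \<le> n" for m n
      using par[OF that] N e by (intro power2_less_imp_less[of _ e]) auto
    then show "\<exists>N. \<forall>m\<ge>N. \<forall>n\<ge>N. norm (y m - y n) < e" by blast
  qed
  then obtain z where z: "y \<longlonglongrightarrow> z" using Cauchy_convergent_iff convergent_def by blast
  have zM: "z \<in> M" using M(2) yM z unfolding closed_sequential_limits by blast
  have zd: "(norm (x - z))\<^sup>2 \<le> d\<^sup>2"
  proof (rule LIMSEQ_le)
    show "(\<lambda>n. (norm (x - y n))\<^sup>2) \<longlonglongrightarrow> (norm (x - z))\<^sup>2" by (intro tendsto_intros z)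
    show "(\<lambda>n. d\<^sup>2 + inverse (real (Suc n))) \<longlonglongrightarrow> d\<^sup>2"
      using tendsto_add[OF tendsto_const LIMSEQ_inverse_real_of_nat, of "d\<^sup>2"] by simp
    show "\<exists>N. \<forall>n\<ge>N. (norm (x - y n))\<^sup>2 \<le> d\<^sup>2 + inverse (real (Suc n))"
      using y by (meson less_imp_le)
  qed
  have "inner (x - z) m = 0" if m: "m \<in> M" for m
  proof (cases "m = 0")
    case False
    define t where "t = inner (x - z) m / inner m m"
    have mm: "inner m m > 0" using False by simp
    have "z + t *\<^sub>R m \<in> M" using M(1) zM m by (simp add: subspace_add subspace_scale)
    then have "d\<^sup>2 \<le> (norm (x - (z + t *\<^sub>R m)))\<^sup>2" using d_le d0 by (intro power_mono) auto
    also have "\<dots> = (norm (x - z))\<^sup>2 - 2 * t * inner (x - z) m + t * t * inner m m"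
      by (simp add: power2_norm_eq_inner inner_simps inner_commute algebra_simps)
    also have "t * t * inner m m = t * inner (x - z) m" using mm by (simp add: t_def)
    finally have "t * inner (x - z) m \<le> 0" using zd by linarith
    then have "(inner (x - z) m)\<^sup>2 \<le> 0"
      using mm by (simp add: t_def power2_eq_square divide_le_0_iff)
    then show ?thesis by simp
  qed simp
  then show ?thesis using that zM by blast
qed

lemma subspace_closure:
  fixes M :: "'a::real_normed_vector set"
  assumes M: "subspace M"
  shows "subspace (closure M)"
  unfolding subspace_def
proof (intro conjI ballI allI)
  show "0 \<in> closure M" using subspace_0[OF M] closure_subset by blast
next
  fix x y assume "x \<in> closure M" "y \<in> closure M"
  then obtain u v where "\<And>n. u n \<in> M" "u \<longlonglongrightarrow> x" "\<And>n. v n \<in> M" "v \<longlonglongrightarrow> y"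
    unfolding closure_sequential by blast
  then show "x + y \<in> closure M"
    unfolding closure_sequential using M
    by (intro exI[of _ "\<lambda>n. u n + v n"]) (auto intro: tendsto_add subspace_add)
next
  fix c x assume "x \<in> closure M"
  then obtain u where "\<And>n. u n \<in> M" "u \<longlonglongrightarrow> x"
    unfolding closure_sequential by blast
  then show "c *\<^sub>R x \<in> closure M"
    unfolding closure_sequential using M
    by (intro exI[of _ "\<lambda>n. c *\<^sub>R u n"]) (auto intro: tendsto_scaleR subspace_scale)
qed

lemma dense_if_orthogonal_complement_trivial:
  fixes M :: "'a::{real_inner, complete_space} set"
  assumes M: "subspace M" and triv: "\<And>x. (\<And>m. m \<in> M \<Longrightarrow> inner x m = 0) \<Longrightarrow> x = 0"
  shows "closure M = UNIV"
proof -
  have "x \<in> closure M" for x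
  proof -
    have "subspace (closure M)" "closed (closure M)"
      using M by (auto intro: subspace_closure)
    then obtain y where y: "y \<in> closure M" "\<And>m. m \<in> closure M \<Longrightarrow> inner (x - y) m = 0"
      using orthogonal_projection_exists by blast
    have "x - y = 0" by (rule triv) (use y(2) closure_subset in blast)
    then show ?thesis using y(1) by simp
  qed
  then show ?thesis by blast
qed

text \<open>By the Baire category theorem one of the closed sets of points whose orbit is bounded by \<open>k\<close>
  contains a ball, and linearity carries the bound from that ball to a ball around the origin.\<close>

lemma uniform_boundedness_sequence:
  fixes T :: "nat \<Rightarrow> 'a::banach \<Rightarrow> 'b::real_normed_vector"
  assumes lin: "\<And>n. bounded_linear (T n)" and bdd: "\<And>x. bounded (range (\<lambda>n. T n x))"
  shows "\<exists>K. \<forall>n x. norm (T n x) \<le> K * norm x"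
proof -
  define E where "E k = {x. \<forall>n. norm (T n x) \<le> real k}" for k :: nat
  have closedE: "closed (E k)" for k
    unfolding E_def
    by (intro closed_Collect_all closed_Collect_le continuous_intros
        bounded_linear.continuous_on[OF lin])
  have cover: "x \<in> \<Union> (range E)" for x
  proof -
    obtain b where "\<And>n. norm (T n x) \<le> b" using bdd[of x] by (auto simp: bounded_iff)
    moreover obtain k :: nat where "b \<le> real k" using real_arch_simple by blast
    ultimately have "x \<in> E k" by (auto simp: E_def intro: order_trans)
    then show ?thesis by blast
  qed
  have "\<exists>k. interior (E k) \<noteq> {}"
  proof (rule ccontr)
    assume "\<not> ?thesis"
    then have "Met_TC.mtopology interior_of \<Union>(range E) = {}"
      using closedE complete_UNIV
      by (intro Met_TC.metric_Baire_category_alt) (auto simp: mcomplete_iff_complete)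
    moreover have "\<Union>(range E) = UNIV" using cover by blast
    ultimately show False by simp
  qed
  then obtain k a where "a \<in> interior (E k)" by blast
  then obtain r where r: "r > 0" "ball a r \<subseteq> E k" by (auto simp: mem_interior)
  have small: "norm (T n z) \<le> 2 * real k" if "norm z < r" for n z
  proof -
    interpret bounded_linear "T n" by (rule lin)
    have "a \<in> E k" "a + z \<in> E k" using that r by (auto simp: subset_iff dist_norm)
    then have "norm (T n (a + z)) \<le> real k" "norm (T n a) \<le> real k" by (auto simp: E_def)
    then show ?thesis using norm_triangle_ineq4[of "T n (a + z)" "T n a"] by (simp add: add)
  qed
  have "norm (T n x) \<le> (4 * real k / r) * norm x" for n x
  proof (cases "x = 0")
    case True
    interpret bounded_linear "T n" by (rule lin)
    show ?thesis using True by (simp add: zero)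
  next
    case False
    interpret bounded_linear "T n" by (rule lin)
    have "norm (T n ((r / (2 * norm x)) *\<^sub>R x)) \<le> 2 * real k"
      using r False by (intro small) simp
    then show ?thesis using r False by (simp add: scaleR field_simps)
  qed
  then show ?thesis by blast
qed

section \<open>Strongly continuous semigroups\<close>

lemma c0_semigroupD:
  assumes "c0_semigroup S"
  shows "0 \<le> t \<Longrightarrow> bounded_linear (S t)"
    and "S 0 = id"
    and "0 \<le> s \<Longrightarrow> 0 \<le> t \<Longrightarrow> S (s + t) x = S s (S t x)"
    and "((\<lambda>t. S t x) \<longlongrightarrow> x) (at_right 0)"
  using assms by (auto simp: c0_semigroup_def)

text \<open>Otherwise some \<open>t\<^sub>n \<rightarrow> 0\<close> would have \<open>\<parallel>S t\<^sub>n\<parallel> > n\<close>, although \<open>S t\<^sub>n z\<close> converges for every \<open>z\<close>; this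
  contradicts uniform boundedness.\<close>

lemma c0_semigroup_bounded_near_0:
  fixes S :: "real \<Rightarrow> 'a::banach \<Rightarrow> 'a"
  assumes S: "c0_semigroup S"
  obtains \<delta> K where "0 < \<delta>" "1 \<le> K" "\<And>t x. 0 \<le> t \<Longrightarrow> t \<le> \<delta> \<Longrightarrow> norm (S t x) \<le> K * norm x"
proof -
  have "\<exists>\<delta>>0. \<exists>K\<ge>1. \<forall>t x. 0 \<le> t \<longrightarrow> t \<le> \<delta> \<longrightarrow> norm (S t x) \<le> K * norm x"
  proof (rule ccontr)
    assume neg: "\<not> ?thesis"
    have "\<forall>n::nat. \<exists>t x. 0 \<le> t \<and> t \<le> inverse (real (Suc n)) \<and> real (Suc n) * norm x < norm (S t x)"
    proof
      fix n :: nat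
      have "inverse (real (Suc n)) > 0" "1 \<le> real (Suc n)" by auto
      then show "\<exists>t x. 0 \<le> t \<and> t \<le> inverse (real (Suc n)) \<and> real (Suc n) * norm x < norm (S t x)"
        using neg by (meson not_le)
    qed
    then obtain t x where t: "\<And>n. 0 \<le> t n" "\<And>n. t n \<le> inverse (real (Suc n))"
      and x: "\<And>n. real (Suc n) * norm (x n) < norm (S (t n) (x n))"
      by metis
    have t_pos: "t n > 0" for n
    proof -
      have "t n \<noteq> 0"
      proof
        assume "t n = 0"
        then have "real (Suc n) * norm (x n) < 1 * norm (x n)"
          using x[of n] c0_semigroupD(2)[OF S] by simp
        moreover have "1 * norm (x n) \<le> real (Suc n) * norm (x n)"
          by (intro mult_right_mono) auto
        ultimately show False by linarith
      qed
      then show ?thesis using t(1)[of n] by simp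
    qed
    have "t \<longlonglongrightarrow> 0"
      by (rule tendsto_sandwich[OF _ _ tendsto_const LIMSEQ_inverse_real_of_nat]) (use t in auto)
    then have t_lim: "filterlim t (at_right 0) sequentially"
      using t_pos by (auto simp: filterlim_at intro!: always_eventually) (metis less_irrefl)
    have "bounded (range (\<lambda>n. S (t n) z))" for z
      by (rule convergent_imp_bounded, rule filterlim_compose[OF c0_semigroupD(4)[OF S] t_lim])
    then obtain K where K: "\<And>n x. norm (S (t n) x) \<le> K * norm x"
      using uniform_boundedness_sequence[of "\<lambda>n. S (t n)"] c0_semigroupD(1)[OF S] t(1) by metis
    obtain n where n: "K \<le> real n" using real_arch_simple by blast
    have "real (Suc n) * norm (x n) < K * norm (x n)" using x[of n] K[of n "x n"] by linarith
    moreover have "K * norm (x n) \<le> real (Suc n) * norm (x n)"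
      using n by (intro mult_right_mono) auto
    ultimately show False by linarith
  qed
  then show ?thesis using that by blast
qed

lemma c0_semigroup_locally_bounded:
  fixes S :: "real \<Rightarrow> 'a::banach \<Rightarrow> 'a"
  assumes S: "c0_semigroup S"
  obtains K where "1 \<le> K" "\<And>t x. 0 \<le> t \<Longrightarrow> t \<le> b \<Longrightarrow> norm (S t x) \<le> K * norm x"
proof -
  obtain \<delta> K where \<delta>: "0 < \<delta>" and K: "1 \<le> K"
    and near: "\<And>t x. 0 \<le> t \<Longrightarrow> t \<le> \<delta> \<Longrightarrow> norm (S t x) \<le> K * norm x"
    using c0_semigroup_bounded_near_0[OF S] by blast
  have *: "norm (S t x) \<le> K ^ Suc n * norm x" if "0 \<le> t" "t \<le> real (Suc n) * \<delta>" for n t x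
    using that
  proof (induction n arbitrary: t)
    case 0
    then show ?case using near by simp
  next
    case (Suc n)
    show ?case
    proof (cases "t \<le> \<delta>")
      case True
      then have "norm (S t x) \<le> K ^ 1 * norm x" using near Suc.prems by simp
      also have "\<dots> \<le> K ^ Suc (Suc n) * norm x"
        using K by (intro mult_right_mono power_increasing) auto
      finally show ?thesis .
    next
      case False
      have "S t x = S \<delta> (S (t - \<delta>) x)"
        using c0_semigroupD(3)[OF S, of \<delta> "t - \<delta>" x] False \<delta> by simp
      then have "norm (S t x) \<le> K * norm (S (t - \<delta>) x)" using near \<delta> by simp
      also have "\<dots> \<le> K * (K ^ Suc n * norm x)"
        using Suc False K by (intro mult_left_mono Suc.IH) (auto simp: algebra_simps)
      finally show ?thesis by (simp add: mult.assoc)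
    qed
  qed
  obtain n :: nat where n: "b / \<delta> \<le> real n" using real_arch_simple by blast
  then have "b \<le> real (Suc n) * \<delta>" using \<delta> by (simp add: field_simps)
  then show ?thesis using that[of "K ^ Suc n"] * K by (meson one_le_power order_trans)
qed

text \<open>The definition only gives continuity from the right at 0. With \<open>m = min s t\<close> both one-sided cases are
  covered by \<open>\<parallel>S s x - S t x\<parallel> = \<parallel>S m (S \<bar>s - t\<bar> x - x)\<parallel>\<close>, where \<open>S m\<close> is bounded uniformly in \<open>s\<close>.\<close>

lemma c0_semigroup_isCont:
  fixes S :: "real \<Rightarrow> 'a::banach \<Rightarrow> 'a"
  assumes S: "c0_semigroup S" and t: "0 < t"
  shows "isCont (\<lambda>t. S t x) t"
proof -
  obtain K where K: "1 \<le> K" "\<And>s x. 0 \<le> s \<Longrightarrow> s \<le> t + 1 \<Longrightarrow> norm (S s x) \<le> K * norm x"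
    using c0_semigroup_locally_bounded[OF S] by blast
  have bd: "norm (S s x - S t x) \<le> K * norm (S \<bar>s - t\<bar> x - x)" if "0 \<le> s" "s \<le> t + 1" for s
  proof -
    define m where "m = min s t"
    have m: "0 \<le> m" "m \<le> t + 1" using t that by (auto simp: m_def)
    interpret bounded_linear "S m" by (rule c0_semigroupD(1)[OF S m(1)])
    have "S (m + \<bar>s - t\<bar>) x = S m (S \<bar>s - t\<bar> x)" using m by (intro c0_semigroupD(3)[OF S]) auto
    then have "norm (S m (S \<bar>s - t\<bar> x - x)) = norm (S (m + \<bar>s - t\<bar>) x - S m x)"
      by (simp add: diff)
    moreover have "\<dots> = norm (S s x - S t x)"
      by (cases "s \<le> t") (auto simp: m_def norm_minus_commute min_def)
    ultimately have "norm (S s x - S t x) = norm (S m (S \<bar>s - t\<bar> x - x))" by simp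
    then show ?thesis using K(2)[OF m] by simp
  qed
  have c0: "((\<lambda>h. S h x) \<longlongrightarrow> x) (at_right 0)" by (rule c0_semigroupD(4)[OF S])
  have "filterlim (\<lambda>s. \<bar>s - t\<bar>) (at_right 0) (at t)"
    unfolding filterlim_at
    by (auto simp: eventually_at_filter intro!: tendsto_eq_intros always_eventually)
  then have "((\<lambda>s. S \<bar>s - t\<bar> x) \<longlongrightarrow> x) (at t)"
    by (rule filterlim_compose[OF c0])
  then have lim: "((\<lambda>s. K * norm (S \<bar>s - t\<bar> x - x)) \<longlongrightarrow> 0) (at t)"
    by (auto intro!: tendsto_eq_intros)
  have "\<forall>\<^sub>F s in at t. s \<in> {0<..<t+1}"
    using t by (intro eventually_at_in_open') auto
  then have "\<forall>\<^sub>F s in at t. norm (S s x - S t x) \<le> K * norm (S \<bar>s - t\<bar> x - x)"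
    by eventually_elim (auto intro: bd)
  then have "((\<lambda>s. S s x - S t x) \<longlongrightarrow> 0) (at t)"
    by (rule Lim_null_comparison[OF _ lim])
  then show ?thesis by (simp add: isCont_def LIM_zero_iff)
qed

lemma c0_semigroup_continuous_on:
  fixes S :: "real \<Rightarrow> 'a::banach \<Rightarrow> 'a"
  assumes S: "c0_semigroup S"
  shows "continuous_on {0..} (\<lambda>t. S t x)"
  unfolding continuous_on_eq_continuous_within
proof
  fix t :: real assume "t \<in> {0..}"
  then consider "t = 0" | "0 < t" by fastforce
  then show "continuous (at t within {0..}) (\<lambda>t. S t x)"
  proof cases
    case 1
    have "at (0::real) within {0..} = at_right 0"
      by (rule at_within_Ici_at_right)
    then show ?thesis using c0_semigroupD(4,2)[OF S] 1 by (simp add: continuous_within)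
  next
    case 2
    then show ?thesis using c0_semigroup_isCont[OF S] continuous_at_imp_continuous_at_within by blast
  qed
qed

lemma has_vector_derivative_if_difference_quotient:
  assumes "((\<lambda>y. (f y - f x) /\<^sub>R (y - x)) \<longlongrightarrow> D) (at x)"
  shows "(f has_vector_derivative D) (at x)"
proof -
  have "((\<lambda>y. norm ((f y - f x) /\<^sub>R (y - x) - D)) \<longlongrightarrow> 0) (at x)"
    using assms by (simp add: LIM_zero tendsto_norm_zero)
  moreover have "\<forall>\<^sub>F y in at x. norm ((f y - f x) /\<^sub>R (y - x) - D)
       = norm (f y - f x - (y - x) *\<^sub>R D) / norm (y - x)"
    unfolding eventually_at_filter
  proof (intro always_eventually allI impI)
    fix y assume "y \<noteq> x"
    then have "(f y - f x) /\<^sub>R (y - x) - D = (f y - f x - (y - x) *\<^sub>R D) /\<^sub>R (y - x)"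
      by (simp add: scaleR_diff_right)
    then show "norm ((f y - f x) /\<^sub>R (y - x) - D) = norm (f y - f x - (y - x) *\<^sub>R D) / norm (y - x)"
      by (simp add: divide_inverse_commute)
  qed
  ultimately have "((\<lambda>y. norm (f y - f x - (y - x) *\<^sub>R D) / norm (y - x)) \<longlongrightarrow> 0) (at x)"
    by (rule Lim_transform_eventually)
  then show ?thesis
    by (simp add: has_vector_derivative_def has_derivative_iff_norm bounded_linear_scaleR_left)
qed

text \<open>The difference quotient at \<open>t\<close> is \<open>S (min s t)\<close> applied to the quotient \<open>q\<close> at 0. On the left side of
  \<open>t\<close> the operator varies with \<open>s\<close>, so the quotient is split as \<open>S (min s t) (q - g) + S (min s t) g\<close>:
  local boundedness handles the first term, continuity of the orbit of \<open>g\<close> the second.\<close>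

lemma generator_orbit_derivative:
  fixes S :: "real \<Rightarrow> 'a::banach \<Rightarrow> 'a"
  assumes S: "c0_semigroup S" and gen: "(f, g) \<in> generator S" and t: "0 < t"
  shows "((\<lambda>t. S t f) has_vector_derivative S t g) (at t)"
proof (rule has_vector_derivative_if_difference_quotient)
  obtain K where K: "1 \<le> K" "\<And>s x. 0 \<le> s \<Longrightarrow> s \<le> t + 1 \<Longrightarrow> norm (S s x) \<le> K * norm x"
    using c0_semigroup_locally_bounded[OF S] by blast
  define q where "q = (\<lambda>h. (S h f - f) /\<^sub>R h)"
  have q: "(q \<longlongrightarrow> g) (at_right 0)" using gen by (simp add: generator_def q_def)
  have abs_lim: "filterlim (\<lambda>s. \<bar>s - t\<bar>) (at_right 0) (at t)"
    unfolding filterlim_at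
    by (auto simp: eventually_at_filter intro!: tendsto_eq_intros always_eventually)
  have quot: "(S s f - S t f) /\<^sub>R (s - t) = S (min s t) (q \<bar>s - t\<bar>)" if "0 \<le> s" "s \<noteq> t" for s
  proof -
    define m where "m = min s t"
    have m: "0 \<le> m" using t that by (auto simp: m_def)
    interpret bounded_linear "S m" by (rule c0_semigroupD(1)[OF S m(1)])
    have "S (m + \<bar>s - t\<bar>) f = S m (S \<bar>s - t\<bar> f)" using m by (intro c0_semigroupD(3)[OF S]) auto
    then have d: "S (m + \<bar>s - t\<bar>) f - S m f = S m (S \<bar>s - t\<bar> f - f)" by (simp add: diff)
    have flip: "inverse (s - t) *\<^sub>R (a - b) = inverse (t - s) *\<^sub>R (b - a)" for a b :: 'a
    proof -
      have "inverse (t - s) = - inverse (s - t)" by (simp flip: inverse_minus_eq)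
      then show ?thesis by (simp add: algebra_simps)
    qed
    have "(S s f - S t f) /\<^sub>R (s - t) = (S (m + \<bar>s - t\<bar>) f - S m f) /\<^sub>R \<bar>s - t\<bar>"
    proof (cases "s \<le> t")
      case True
      then show ?thesis using flip[of "S s f" "S t f"] by (simp add: m_def)
    next
      case False
      then show ?thesis by (simp add: m_def)
    qed
    then have "(S s f - S t f) /\<^sub>R (s - t) = S m (S \<bar>s - t\<bar> f - f) /\<^sub>R \<bar>s - t\<bar>"
      by (simp only: d)
    then show ?thesis by (simp only: q_def scaleR m_def[symmetric])
  qed
  have lim1: "((\<lambda>s. K * norm (q \<bar>s - t\<bar> - g)) \<longlongrightarrow> 0) (at t)"
    using filterlim_compose[OF q abs_lim] by (auto intro!: tendsto_eq_intros)
  have ev: "\<forall>\<^sub>F s in at t. s \<in> {0<..<t+1} \<and> s \<noteq> t"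
    using t by (intro eventually_conj eventually_at_in_open') (auto simp: eventually_at_filter)
  have lim2: "((\<lambda>s. S (min s t) (q \<bar>s - t\<bar> - g)) \<longlongrightarrow> 0) (at t)"
    by (rule Lim_null_comparison[OF eventually_mono[OF ev] lim1]) (use t in \<open>auto intro!: K(2)\<close>)
  have lim3: "((\<lambda>s. S (min s t) g) \<longlongrightarrow> S t g) (at t)"
    by (rule isCont_tendsto_compose[OF c0_semigroup_isCont[OF S t]]) (auto intro!: tendsto_eq_intros)
  have "((\<lambda>s. S (min s t) (q \<bar>s - t\<bar> - g) + S (min s t) g) \<longlongrightarrow> S t g) (at t)"
    using tendsto_add[OF lim2 lim3] by simp
  then show "((\<lambda>s. (S s f - S t f) /\<^sub>R (s - t)) \<longlongrightarrow> S t g) (at t)"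
  proof (rule Lim_transform_eventually)
    show "\<forall>\<^sub>F s in at t. S (min s t) (q \<bar>s - t\<bar> - g) + S (min s t) g = (S s f - S t f) /\<^sub>R (s - t)"
      using ev
    proof eventually_elim
      case (elim s)
      interpret bounded_linear "S (min s t)" using elim t by (intro c0_semigroupD(1)[OF S]) auto
      show ?case using quot[of s] elim by (simp add: diff)
    qed
  qed
qed

lemma generator_invariant:
  fixes S :: "real \<Rightarrow> 'a::banach \<Rightarrow> 'a"
  assumes S: "c0_semigroup S" and gen: "(f, g) \<in> generator S" and t: "0 \<le> t"
  shows "(S t f, S t g) \<in> generator S"
proof -
  interpret bounded_linear "S t" by (rule c0_semigroupD(1)[OF S t])
  have "((\<lambda>h. S t ((S h f - f) /\<^sub>R h)) \<longlongrightarrow> S t g) (at_right 0)"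
    using gen by (intro tendsto) (simp add: generator_def)
  moreover have "\<forall>\<^sub>F h in at_right 0. S t ((S h f - f) /\<^sub>R h) = (S h (S t f) - S t f) /\<^sub>R h"
    unfolding eventually_at_filter
  proof (intro always_eventually allI impI)
    fix h :: real assume "h \<in> {0<..}"
    then show "S t ((S h f - f) /\<^sub>R h) = (S h (S t f) - S t f) /\<^sub>R h"
      using c0_semigroupD(3)[OF S, of h t f] c0_semigroupD(3)[OF S, of t h f] t
      by (simp add: diff scaleR add.commute)
  qed
  ultimately show ?thesis unfolding generator_def by (auto elim: Lim_transform_eventually)
qed

lemma generator_eigenvector_orbit:
  fixes S :: "real \<Rightarrow> 'a::banach \<Rightarrow> 'a"
  assumes S: "c0_semigroup S" and gen: "(f, r *\<^sub>R f) \<in> generator S" and t: "0 \<le> t"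
  shows "S t f = exp (r * t) *\<^sub>R f"
proof (cases "t = 0")
  case True
  then show ?thesis using c0_semigroupD(2)[OF S] by simp
next
  case False
  define w where "w = (\<lambda>s. exp (- (r * s)) *\<^sub>R S s f)"
  have "((\<lambda>s. exp (- (r * s)) *\<^sub>R S s f) has_vector_derivative 0) (at s)" if "0 < s" for s
  proof -
    have e: "((\<lambda>s. exp (- (r * s))) has_real_derivative - r * exp (- (r * s))) (at s)"
      by (auto intro!: derivative_eq_intros)
    interpret bounded_linear "S s" using that by (intro c0_semigroupD(1)[OF S]) auto
    show ?thesis
      using has_vector_derivative_scaleR[OF e generator_orbit_derivative[OF S gen that]]
      by (simp add: scaleR algebra_simps)
  qed
  then have "(w has_vector_derivative 0) (at s)" if "0 < s" for s using that by (simp add: w_def)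
  moreover have "continuous_on {0..t} w" unfolding w_def
    by (intro continuous_intros continuous_on_subset[OF c0_semigroup_continuous_on[OF S]]) auto
  ultimately have "((\<lambda>_. 0) has_integral w t - w 0) {0..t}"
    using t by (intro fundamental_theorem_of_calculus_interior) auto
  then have "w t = w 0" using has_integral_unique[OF has_integral_0] by (metis eq_iff_diff_eq_0)
  then have "exp (r * t) *\<^sub>R w t = exp (r * t) *\<^sub>R f"
    using c0_semigroupD(2)[OF S] by (simp add: w_def)
  then show ?thesis by (simp add: w_def flip: exp_add)
qed

section \<open>Self-adjoint semigroups and their asymptotic covariance\<close>

text \<open>For \<open>f\<close> in the domain, \<open>e\<^bsup>-2ps\<^esup> \<parallel>S s f\<parallel>\<^sup>2\<close> has nonpositive derivative; the bound extends by density.\<close>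

lemma dissipative_generator_decay:
  fixes S :: "real \<Rightarrow> 'a::{real_inner, banach} \<Rightarrow> 'a"
  assumes S: "c0_semigroup S" and dense: "closure (Domain (generator S)) = UNIV"
    and diss: "\<And>f g. (f, g) \<in> generator S \<Longrightarrow> inner g f \<le> p * inner f f"
    and t: "0 \<le> t"
  shows "norm (S t x) \<le> exp (p * t) * norm x"
proof -
  have on_domain: "norm (S t f) \<le> exp (p * t) * norm f" if fg: "(f, g) \<in> generator S" for f g
  proof -
    define w where "w = (\<lambda>s. exp (- (2 * p * s)) * inner (S s f) (S s f))"
    have "w t \<le> w 0"
    proof (rule DERIV_nonpos_imp_decreasing_open[OF t])
      fix s assume s: "0 < s" "s < t"
      have "((\<lambda>s. inner (S s f) (S s f)) has_real_derivative 2 * inner (S s g) (S s f)) (at s)"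
        using bounded_bilinear.has_vector_derivative[OF bounded_bilinear_inner
            generator_orbit_derivative[OF S fg s(1)] generator_orbit_derivative[OF S fg s(1)]]
        by (simp add: has_real_derivative_iff_has_vector_derivative inner_commute)
      then have "(w has_real_derivative exp (- (2 * p * s)) *
          (2 * inner (S s g) (S s f) - 2 * p * inner (S s f) (S s f))) (at s)"
        unfolding w_def by (auto intro!: derivative_eq_intros simp: algebra_simps)
      moreover have "inner (S s g) (S s f) \<le> p * inner (S s f) (S s f)"
        using generator_invariant[OF S fg, of s] s by (intro diss) auto
      then have "exp (- (2 * p * s)) *
          (2 * inner (S s g) (S s f) - 2 * p * inner (S s f) (S s f)) \<le> 0"
        by (intro mult_nonneg_nonpos) auto
      ultimately show "\<exists>y. (w has_real_derivative y) (at s) \<and> y \<le> 0" by blast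
    next
      have "continuous_on {0..t} (\<lambda>s. S s f)"
        by (rule continuous_on_subset[OF c0_semigroup_continuous_on[OF S]]) auto
      then show "continuous_on {0..t} w" unfolding w_def by (intro continuous_intros)
    qed
    then have "exp (2 * p * t) * w t \<le> exp (2 * p * t) * inner f f"
      using c0_semigroupD(2)[OF S] by (simp add: w_def)
    then have "(norm (S t f))\<^sup>2 \<le> exp (2 * p * t) * inner f f"
      by (simp add: w_def power2_norm_eq_inner flip: mult.assoc exp_add)
    also have "\<dots> = (exp (p * t) * norm f)\<^sup>2"
      by (simp add: power_mult_distrib power2_norm_eq_inner mult.assoc flip: exp_of_nat_mult)
    finally show ?thesis by (rule power2_le_imp_le) simp
  qed
  have "closed {x. norm (S t x) \<le> exp (p * t) * norm x}"
    by (intro closed_Collect_le continuous_intros bounded_linear.continuous_on[OF c0_semigroupD(1)[OF S t]])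
  then have "closure (Domain (generator S)) \<subseteq> {x. norm (S t x) \<le> exp (p * t) * norm x}"
    by (rule closure_minimal[rotated]) (use on_domain in auto)
  then show ?thesis using dense by auto
qed

text \<open>For \<open>f\<close> and \<open>f'\<close> in the domain, \<open>\<langle>S s f, S (t - s) f'\<rangle>\<close> has derivative 0 in \<open>s\<close>; comparing \<open>s = 0\<close>
  with \<open>s = t\<close> and using density in each argument gives the claim.\<close>

lemma symmetric_generator_self_adjoint:
  fixes S :: "real \<Rightarrow> 'a::{real_inner, banach} \<Rightarrow> 'a"
  assumes S: "c0_semigroup S" and dense: "closure (Domain (generator S)) = UNIV"
    and sym: "\<And>f g f' g'. (f, g) \<in> generator S \<Longrightarrow> (f', g') \<in> generator S \<Longrightarrow> inner g f' = inner f g'"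
    and t: "0 \<le> t"
  shows "inner (S t x) y = inner x (S t y)"
proof -
  have on_domain: "inner (S t f) f' = inner f (S t f')"
    if fg: "(f, g) \<in> generator S" "(f', g') \<in> generator S" for f g f' g'
  proof -
    define w where "w = (\<lambda>s. inner (S s f) (S (t - s) f'))"
    have "((\<lambda>_. 0) has_integral w t - w 0) {0..t}"
    proof (rule fundamental_theorem_of_calculus_interior[OF t])
      have c: "continuous_on {0..} (\<lambda>s. S s z)" for z by (rule c0_semigroup_continuous_on[OF S])
      show "continuous_on {0..t} w" unfolding w_def
        by (intro continuous_intros continuous_on_subset[OF c] continuous_on_compose2[OF c]) auto
      fix s assume s: "s \<in> {0<..<t}"
      have "((\<lambda>s. S (t - s) f') has_vector_derivative (-1) *\<^sub>R S (t - s) g') (at s)"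
        using s by (intro vector_diff_chain_at[of "\<lambda>s. t - s" "-1" s "\<lambda>r. S r f'", unfolded o_def]
              generator_orbit_derivative[OF S fg(2)]) (auto intro!: derivative_eq_intros)
      then have "(w has_vector_derivative
          inner (S s f) ((-1) *\<^sub>R S (t - s) g') + inner (S s g) (S (t - s) f')) (at s)"
        unfolding w_def using s
        by (intro bounded_bilinear.has_vector_derivative[OF bounded_bilinear_inner]
              generator_orbit_derivative[OF S fg(1)]) auto
      moreover have "inner (S s g) (S (t - s) f') = inner (S s f) (S (t - s) g')"
        using s by (intro sym generator_invariant[OF S] fg) auto
      ultimately show "(w has_vector_derivative 0) (at s)" by simp
    qed
    then have "w t - w 0 = 0" using has_integral_unique[OF has_integral_0] by metis
    then show ?thesis using c0_semigroupD(2)[OF S] by (simp add: w_def)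
  qed
  note cont = bounded_linear.continuous_on[OF c0_semigroupD(1)[OF S t]]
  have half: "inner (S t f) y = inner f (S t y)" if fg: "(f, g) \<in> generator S" for f g y
  proof -
    have "closed {y. inner (S t f) y = inner f (S t y)}"
      by (intro closed_Collect_eq continuous_intros cont)
    then have "closure (Domain (generator S)) \<subseteq> {y. inner (S t f) y = inner f (S t y)}"
      by (rule closure_minimal[rotated]) (use on_domain fg in auto)
    then show ?thesis using dense by auto
  qed
  have "closed {x. inner (S t x) y = inner x (S t y)}"
    by (intro closed_Collect_eq continuous_intros cont)
  then have "closure (Domain (generator S)) \<subseteq> {x. inner (S t x) y = inner x (S t y)}"
    by (rule closure_minimal[rotated]) (use half in auto)
  then show ?thesis using dense by auto
qed

lemma convergent_at_top_if_Cauchy_bound: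
  fixes F :: "real \<Rightarrow> 'a::banach"
  assumes bound: "\<And>s t. 0 \<le> s \<Longrightarrow> s \<le> t \<Longrightarrow> norm (F t - F s) \<le> B s"
    and B: "(B \<longlongrightarrow> 0) at_top"
  obtains l where "(F \<longlongrightarrow> l) at_top"
proof -
  have B_seq: "(\<lambda>n. B (real n)) \<longlonglongrightarrow> 0"
    by (rule filterlim_compose[OF B filterlim_real_sequentially])
  have "Cauchy (\<lambda>n. F (real n))"
  proof (rule CauchyI')
    fix e :: real assume "0 < e"
    then obtain N where N: "\<And>n. N \<le> n \<Longrightarrow> B (real n) < e"
      using order_tendstoD(2)[OF B_seq] by (auto simp: eventually_sequentially)
    have "norm (F (real m) - F (real n)) < e" if "N \<le> m" "m < n" for m n
      using bound[of "real m" "real n"] N[of m] that by (simp add: norm_minus_commute)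
    then show "\<exists>M. \<forall>m\<ge>M. \<forall>n>m. dist (F (real m)) (F (real n)) < e"
      unfolding dist_norm by blast
  qed
  then obtain l where l: "(\<lambda>n. F (real n)) \<longlonglongrightarrow> l"
    using Cauchy_convergent_iff convergent_def by blast
  have "norm (F t - l) \<le> B t" if "0 \<le> t" for t
  proof (rule tendsto_upperbound)
    show "(\<lambda>n. norm (F t - F (real n))) \<longlonglongrightarrow> norm (F t - l)" by (intro tendsto_intros l)
    obtain N :: nat where "t \<le> real N" using real_arch_simple by blast
    then show "\<forall>\<^sub>F n in sequentially. norm (F t - F (real n)) \<le> B t"
      unfolding eventually_sequentially
      using bound[OF that] by (intro exI[of _ N]) (auto simp: norm_minus_commute[of "F t"])
  qed simp
  then have "\<forall>\<^sub>F t in at_top. norm (F t - l) \<le> B t"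
    by (auto intro: eventually_mono[OF eventually_ge_at_top[of 0]])
  then have "((\<lambda>t. F t - l) \<longlongrightarrow> 0) at_top" by (rule Lim_null_comparison[OF _ B])
  then show ?thesis using that by (simp add: LIM_zero_iff)
qed

text \<open>The constant \<open>adjoint\<close> is defined by choice, so it denotes the expected operator only once an adjoint
  has been exhibited; here \<open>S \<tau>\<close> itself is one.\<close>

lemma covariance_operator_self_adjoint:
  fixes S :: "real \<Rightarrow> 'a::{real_inner, banach} \<Rightarrow> 'a"
  assumes S: "c0_semigroup S"
    and self_adj: "\<And>t x y. 0 \<le> t \<Longrightarrow> inner (S t x) y = inner x (S t y)"
  shows "covariance_operator 1 id id S t x = integral {0..t} (\<lambda>\<tau>. S (2 * \<tau>) x)"
proof -
  have "adjoint (id :: 'a \<Rightarrow> 'a) = id" by (rule adjoint_unique) simp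
  moreover have "S \<tau> (adjoint (S \<tau>) x) = S (2 * \<tau>) x" if "0 \<le> \<tau>" for \<tau>
  proof -
    have "adjoint (S \<tau>) = S \<tau>" using self_adj[OF that] by (intro adjoint_unique) blast
    then show ?thesis using c0_semigroupD(3)[OF S that that, of x] by simp
  qed
  ultimately show ?thesis
    unfolding covariance_operator_def by (auto intro!: Henstock_Kurzweil_Integration.integral_cong)
qed

lemma covariance_integrable:
  fixes S :: "real \<Rightarrow> 'a::banach \<Rightarrow> 'a"
  assumes S: "c0_semigroup S" and "0 \<le> s"
  shows "(\<lambda>\<tau>. S (2 * \<tau>) x) integrable_on {s..t}"
  by (intro integrable_continuous_real continuous_on_compose2[OF c0_semigroup_continuous_on[OF S]]
      continuous_intros) (use assms(2) in auto)

lemma norm_covariance_integral_le: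
  fixes S :: "real \<Rightarrow> 'a::banach \<Rightarrow> 'a"
  assumes S: "c0_semigroup S"
    and decay: "\<And>t x. 0 \<le> t \<Longrightarrow> norm (S t x) \<le> exp (p * t) * norm x" and p: "p < 0"
    and st: "0 \<le> s" "s \<le> t"
  shows "norm (integral {s..t} (\<lambda>\<tau>. S (2 * \<tau>) x)) \<le> exp (2 * p * s) / (- 2 * p) * norm x"
proof -
  have g: "((\<lambda>\<tau>. exp (2 * p * \<tau>) * norm x) has_integral
      exp (2 * p * t) / (2 * p) * norm x - exp (2 * p * s) / (2 * p) * norm x) {s..t}"
    using p by (intro fundamental_theorem_of_calculus[OF st(2)])
      (auto intro!: derivative_eq_intros simp flip: has_real_derivative_iff_has_vector_derivative)
  have "norm (integral {s..t} (\<lambda>\<tau>. S (2 * \<tau>) x)) \<le> integral {s..t} (\<lambda>\<tau>. exp (2 * p * \<tau>) * norm x)"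
  proof (rule Henstock_Kurzweil_Integration.integral_norm_bound_integral)
    show "(\<lambda>\<tau>. S (2 * \<tau>) x) integrable_on {s..t}" by (rule covariance_integrable[OF S st(1)])
    show "(\<lambda>\<tau>. exp (2 * p * \<tau>) * norm x) integrable_on {s..t}" using g by blast
    show "norm (S (2 * \<tau>) x) \<le> exp (2 * p * \<tau>) * norm x" if "\<tau> \<in> {s..t}" for \<tau>
      using decay[of "2 * \<tau>" x] that st by (simp add: algebra_simps)
  qed
  also have "\<dots> = exp (2 * p * t) / (2 * p) * norm x + exp (2 * p * s) / (- 2 * p) * norm x"
    using integral_unique[OF g] by simp
  also have "\<dots> \<le> exp (2 * p * s) / (- 2 * p) * norm x"
    using p by (simp add: mult_le_0_iff divide_le_0_iff)
  finally show ?thesis .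
qed

text \<open>\<open>Lim\<close> is a definite description; exponential decay makes the integrals a Cauchy net, so that the
  limit it describes exists.\<close>

lemma asymptotic_covariance_converges:
  fixes S :: "real \<Rightarrow> 'a::{real_inner, banach} \<Rightarrow> 'a"
  assumes S: "c0_semigroup S"
    and self_adj: "\<And>t x y. 0 \<le> t \<Longrightarrow> inner (S t x) y = inner x (S t y)"
    and decay: "\<And>t x. 0 \<le> t \<Longrightarrow> norm (S t x) \<le> exp (p * t) * norm x" and p: "p < 0"
  shows "((\<lambda>t. integral {0..t} (\<lambda>\<tau>. S (2 * \<tau>) x)) \<longlongrightarrow> asymptotic_covariance 1 id id S x) at_top"
proof -
  define F where "F = (\<lambda>t. integral {0..t} (\<lambda>\<tau>. S (2 * \<tau>) x))"
  define B where "B = (\<lambda>s. exp (2 * p * s) / (- 2 * p) * norm x)"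
  have "norm (F t - F s) \<le> B s" if st: "0 \<le> s" "s \<le> t" for s t
  proof -
    have "F t - F s = integral {s..t} (\<lambda>\<tau>. S (2 * \<tau>) x)"
      using Henstock_Kurzweil_Integration.integral_combine[OF st covariance_integrable[OF S, of 0 x t]]
      by (simp add: F_def algebra_simps)
    then show ?thesis using norm_covariance_integral_le[OF S decay p st] by (simp add: B_def)
  qed
  moreover have "(B \<longlongrightarrow> 0) at_top"
  proof -
    have "filterlim (\<lambda>s. 2 * p * s) at_bot at_top"
      using p by (intro filterlim_tendsto_neg_mult_at_bot[OF tendsto_const] filterlim_ident) auto
    then have "((\<lambda>s. exp (2 * p * s)) \<longlongrightarrow> 0) at_top"
      by (rule filterlim_compose[OF exp_at_bot])
    then show ?thesis
      unfolding B_def by (intro tendsto_mult_left_zero tendsto_divide_zero)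
  qed
  ultimately obtain l where l: "(F \<longlongrightarrow> l) at_top"
    by (rule convergent_at_top_if_Cauchy_bound)
  have "asymptotic_covariance 1 id id S x = Lim at_top F"
    by (simp add: asymptotic_covariance_def F_def covariance_operator_self_adjoint[OF S self_adj])
  also have "\<dots> = l" by (rule tendsto_Lim[OF _ l]) simp
  finally show ?thesis using l by (simp add: F_def)
qed

text \<open>\<open>onorm\<close> is a supremum of reals, whose value is unspecified for an unbounded operator; boundedness is
  what gives \<open>\<parallel>V\<^sub>\<infinity> x\<parallel> \<le> \<parallel>V\<^sub>\<infinity>\<parallel> \<parallel>x\<parallel>\<close>.\<close>

lemma asymptotic_covariance_bounded_linear:
  fixes S :: "real \<Rightarrow> 'a::{real_inner, banach} \<Rightarrow> 'a"
  assumes S: "c0_semigroup S"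
    and self_adj: "\<And>t x y. 0 \<le> t \<Longrightarrow> inner (S t x) y = inner x (S t y)"
    and decay: "\<And>t x. 0 \<le> t \<Longrightarrow> norm (S t x) \<le> exp (p * t) * norm x" and p: "p < 0"
  shows "bounded_linear (asymptotic_covariance 1 id id S)"
proof -
  define V where "V = asymptotic_covariance 1 id id S"
  define F where "F = (\<lambda>x t. integral {0..t} (\<lambda>\<tau>. S (2 * \<tau>) x))"
  have lim: "(F x \<longlongrightarrow> V x) at_top" for x
    using asymptotic_covariance_converges[OF assms] by (simp add: F_def V_def)
  have lin: "bounded_linear (S (2 * \<tau>))" if "0 \<le> \<tau>" for \<tau>
    using that by (intro c0_semigroupD(1)[OF S]) auto
  note int = covariance_integrable[OF S order_refl]
  show ?thesis unfolding V_def[symmetric]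
  proof (rule bounded_linear_intro)
    fix x y :: 'a and r :: real
    have "F (x + y) t = F x t + F y t" for t
    proof -
      have "F (x + y) t = integral {0..t} (\<lambda>\<tau>. S (2 * \<tau>) x + S (2 * \<tau>) y)"
        unfolding F_def by (intro Henstock_Kurzweil_Integration.integral_cong)
          (auto simp: linear_add[OF bounded_linear.linear[OF lin]])
      then show ?thesis by (simp add: F_def Henstock_Kurzweil_Integration.integral_add[OF int int])
    qed
    then have "(F (x + y) \<longlongrightarrow> V x + V y) at_top"
      using tendsto_add[OF lim[of x] lim[of y]] by presburger
    then show "V (x + y) = V x + V y"
      by (rule tendsto_unique[OF trivial_limit_at_top_linorder lim])
    have "F (r *\<^sub>R x) t = r *\<^sub>R F x t" for t
    proof -
      have "F (r *\<^sub>R x) t = integral {0..t} (\<lambda>\<tau>. r *\<^sub>R S (2 * \<tau>) x)"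
        unfolding F_def by (intro Henstock_Kurzweil_Integration.integral_cong)
          (auto simp: linear_scale[OF bounded_linear.linear[OF lin]])
      then show ?thesis by (simp add: F_def)
    qed
    then have "(F (r *\<^sub>R x) \<longlongrightarrow> r *\<^sub>R V x) at_top"
      using tendsto_scaleR[OF tendsto_const lim[of x]] by presburger
    then show "V (r *\<^sub>R x) = r *\<^sub>R V x"
      by (rule tendsto_unique[OF trivial_limit_at_top_linorder lim])
    show "norm (V x) \<le> norm x * (1 / (- 2 * p))"
    proof (rule tendsto_upperbound)
      show "((\<lambda>t. norm (F x t)) \<longlongrightarrow> norm (V x)) at_top" by (intro tendsto_intros lim)
      show "\<forall>\<^sub>F t in at_top. norm (F x t) \<le> norm x * (1 / (- 2 * p))"
      proof (rule eventually_mono[OF eventually_ge_at_top[of 0]])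
        fix t :: real assume t: "0 \<le> t"
        show "norm (F x t) \<le> norm x * (1 / (- 2 * p))"
          using norm_covariance_integral_le[OF S decay p order_refl t] by (simp add: F_def)
      qed
    qed simp
  qed
qed

text \<open>\<open>V\<^sub>\<infinity>\<close> inverts \<open>-2 A\<close>: since \<open>S (2 \<tau>) g\<close> is half the derivative of \<open>S (2 \<tau>) f\<close>, its integral over
  \<open>[0, t]\<close> is \<open>(S (2 t) f - f) / 2\<close>, and the first term decays.\<close>

lemma asymptotic_covariance_generator:
  fixes S :: "real \<Rightarrow> 'a::{real_inner, banach} \<Rightarrow> 'a"
  assumes S: "c0_semigroup S"
    and self_adj: "\<And>t x y. 0 \<le> t \<Longrightarrow> inner (S t x) y = inner x (S t y)"
    and decay: "\<And>t x. 0 \<le> t \<Longrightarrow> norm (S t x) \<le> exp (p * t) * norm x" and p: "p < 0"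
    and gen: "(f, g) \<in> generator S"
  shows "asymptotic_covariance 1 id id S g = - (1/2) *\<^sub>R f"
proof -
  have F: "integral {0..t} (\<lambda>\<tau>. S (2 * \<tau>) g) = (1/2) *\<^sub>R (S (2 * t) f - f)" if t: "0 \<le> t" for t
  proof -
    have "((\<lambda>\<tau>. S (2 * \<tau>) g) has_integral
        (1/2) *\<^sub>R S (2 * t) f - (1/2) *\<^sub>R S (2 * 0) f) {0..t}"
    proof (rule fundamental_theorem_of_calculus_interior[OF t])
      show "continuous_on {0..t} (\<lambda>\<tau>. (1/2) *\<^sub>R S (2 * \<tau>) f)"
        by (intro continuous_intros continuous_on_compose2[OF c0_semigroup_continuous_on[OF S]]) auto
      fix s assume s: "s \<in> {0<..<t}"
      have "((\<lambda>\<tau>. S (2 * \<tau>) f) has_vector_derivative 2 *\<^sub>R S (2 * s) g) (at s)"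
        using s by (intro vector_diff_chain_at[of "\<lambda>s. 2 * s" 2 s "\<lambda>r. S r f", unfolded o_def]
              generator_orbit_derivative[OF S gen]) (auto intro!: derivative_eq_intros)
      then have "((\<lambda>\<tau>. (1/2) *\<^sub>R S (2 * \<tau>) f) has_vector_derivative (1/2) *\<^sub>R 2 *\<^sub>R S (2 * s) g) (at s)"
        by (rule bounded_linear.has_vector_derivative[OF bounded_linear_scaleR_right])
      then show "((\<lambda>\<tau>. (1/2) *\<^sub>R S (2 * \<tau>) f) has_vector_derivative S (2 * s) g) (at s)" by simp
    qed
    then show ?thesis using c0_semigroupD(2)[OF S] by (simp add: integral_unique scaleR_diff_right)
  qed
  have "((\<lambda>t. S (2 * t) f) \<longlongrightarrow> 0) at_top"
  proof (rule Lim_null_comparison)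
    show "\<forall>\<^sub>F t in at_top. norm (S (2 * t) f) \<le> exp (p * (2 * t)) * norm f"
      by (rule eventually_mono[OF eventually_ge_at_top[of 0]]) (auto intro: decay)
    have "filterlim (\<lambda>t. p * (2 * t)) at_bot at_top"
      using p by (intro filterlim_tendsto_neg_mult_at_bot[OF tendsto_const]
          filterlim_tendsto_pos_mult_at_top[OF tendsto_const] filterlim_ident) auto
    then have "((\<lambda>t. exp (p * (2 * t))) \<longlongrightarrow> 0) at_top"
      by (rule filterlim_compose[OF exp_at_bot])
    then show "((\<lambda>t. exp (p * (2 * t)) * norm f) \<longlongrightarrow> 0) at_top"
      by (rule tendsto_mult_left_zero)
  qed
  then have "((\<lambda>t. (1/2) *\<^sub>R (S (2 * t) f - f)) \<longlongrightarrow> - (1/2) *\<^sub>R f) at_top"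
    by (auto intro!: tendsto_eq_intros)
  then have "((\<lambda>t. integral {0..t} (\<lambda>\<tau>. S (2 * \<tau>) g)) \<longlongrightarrow> - (1/2) *\<^sub>R f) at_top"
    by (rule Lim_transform_eventually)
      (rule eventually_mono[OF eventually_ge_at_top[of 0]], simp add: F)
  then show ?thesis
    using tendsto_unique[OF trivial_limit_at_top_linorder
        asymptotic_covariance_converges[OF S self_adj decay p]] by blast
qed

section \<open>Test functions as elements of the Hilbert space\<close>

instance l2 :: banach ..

lemma iterated_deriv_has_derivative:
  assumes "test_function \<phi>"
  shows "((deriv ^^ n) \<phi> has_real_derivative (deriv ^^ Suc n) \<phi> x) (at x)"
  using assms by (simp add: test_function_def DERIV_deriv_iff_field_differentiable)

lemma test_function_has_derivative:
  assumes "test_function \<phi>"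
  shows "(\<phi> has_real_derivative deriv \<phi> x) (at x)"
  using iterated_deriv_has_derivative[OF assms, of 0] by simp

lemma test_function_continuous_on: "test_function \<phi> \<Longrightarrow> continuous_on UNIV \<phi>"
  by (intro continuous_at_imp_continuous_on ballI DERIV_isCont[OF test_function_has_derivative])

lemma test_function_deriv:
  assumes \<phi>: "test_function \<phi>"
  shows "test_function (deriv \<phi>)"
proof -
  obtain R where R: "\<And>x. R < \<bar>x\<bar> \<Longrightarrow> \<phi> x = 0" using \<phi> by (auto simp: test_function_def)
  have "deriv \<phi> x = 0" if x: "R < \<bar>x\<bar>" for x
  proof -
    have "open {x::real. R < \<bar>x\<bar>}" by (intro open_Collect_less continuous_intros)
    then have "\<forall>\<^sub>F y in nhds x. \<phi> y = 0"
      using x R by (auto simp: eventually_nhds)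
    then show ?thesis by (subst deriv_cong_ev[of _ "\<lambda>_. 0"]) auto
  qed
  moreover have "(deriv ^^ n) (deriv \<phi>) = (deriv ^^ Suc n) \<phi>" for n
    by (simp only: funpow_Suc_right o_apply)
  ultimately show ?thesis using \<phi> unfolding test_function_def by metis
qed

lemma test_function_iterated_deriv: "test_function \<phi> \<Longrightarrow> test_function ((deriv ^^ k) \<phi>)"
  by (induction k) (auto intro: test_function_deriv)

lemma iterated_deriv_affine_combination:
  assumes "test_function \<phi>" "test_function \<psi>"
  shows "(deriv ^^ n) (\<lambda>x. a * \<phi> x + \<psi> x) = (\<lambda>x. a * (deriv ^^ n) \<phi> x + (deriv ^^ n) \<psi> x)"
proof (induction n)
  case (Suc n)
  then show ?case
    using iterated_deriv_has_derivative[OF assms(1)] iterated_deriv_has_derivative[OF assms(2)]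
    by (auto intro!: ext DERIV_imp_deriv derivative_eq_intros)
qed simp

lemma iterated_deriv_dilation:
  assumes "test_function \<phi>"
  shows "(deriv ^^ n) (\<lambda>x. \<phi> (c * x)) = (\<lambda>x. c ^ n * (deriv ^^ n) \<phi> (c * x))"
proof (induction n)
  case (Suc n)
  have "((\<lambda>x. (deriv ^^ n) \<phi> (c * x)) has_real_derivative (deriv ^^ Suc n) \<phi> (c * x) * c) (at x)" for x
    by (rule DERIV_chain2[OF iterated_deriv_has_derivative[OF assms]])
      (auto intro!: derivative_eq_intros)
  then show ?case
    using Suc by (auto intro!: ext DERIV_imp_deriv derivative_eq_intros)
qed simp

lemma test_function_affine_combination:
  assumes \<phi>: "test_function \<phi>" and \<psi>: "test_function \<psi>"
  shows "test_function (\<lambda>x. a * \<phi> x + \<psi> x)"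
  unfolding test_function_def iterated_deriv_affine_combination[OF assms]
proof (intro conjI allI)
  fix n x
  show "(\<lambda>x. a * (deriv ^^ n) \<phi> x + (deriv ^^ n) \<psi> x) field_differentiable at x"
    using \<phi> \<psi> by (auto simp: test_function_def
        intro!: field_differentiable_add field_differentiable_mult field_differentiable_const)
  obtain R R' where "\<And>x. R < \<bar>x\<bar> \<Longrightarrow> \<phi> x = 0" "\<And>x. R' < \<bar>x\<bar> \<Longrightarrow> \<psi> x = 0"
    using \<phi> \<psi> by (auto simp: test_function_def)
  then show "\<exists>R. \<forall>x. R < \<bar>x\<bar> \<longrightarrow> a * \<phi> x + \<psi> x = 0"
    by (intro exI[of _ "max R R'"]) auto
qed

lemma test_function_dilation:
  assumes \<phi>: "test_function \<phi>" and c: "0 < c"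
  shows "test_function (\<lambda>x. \<phi> (c * x))"
  unfolding test_function_def iterated_deriv_dilation[OF \<phi>]
proof (intro conjI allI)
  fix n x
  have "((\<lambda>x. (deriv ^^ n) \<phi> (c * x)) has_real_derivative (deriv ^^ Suc n) \<phi> (c * x) * c) (at x)"
    by (rule DERIV_chain2[OF iterated_deriv_has_derivative[OF \<phi>]])
      (auto intro!: derivative_eq_intros)
  then show "(\<lambda>x. c ^ n * (deriv ^^ n) \<phi> (c * x)) field_differentiable at x"
    by (intro field_differentiable_mult field_differentiable_const)
      (auto simp: field_differentiable_def)
  obtain R where "\<And>x. R < \<bar>x\<bar> \<Longrightarrow> \<phi> x = 0" using \<phi> by (auto simp: test_function_def)
  then show "\<exists>R. \<forall>x. R < \<bar>x\<bar> \<longrightarrow> \<phi> (c * x) = 0"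
    using c by (intro exI[of _ "R / c"]) (auto simp: abs_mult field_simps)
qed

lemma test_function_zero: "test_function (\<lambda>x. 0)"
proof -
  have "(deriv ^^ n) (\<lambda>x::real. 0::real) = (\<lambda>x. 0)" for n by (induction n) auto
  then show ?thesis by (simp add: test_function_def)
qed

lemma integrable_continuous_compact_support:
  fixes f :: "real \<Rightarrow> real"
  assumes "continuous_on UNIV f" "\<And>x. R < \<bar>x\<bar> \<Longrightarrow> f x = 0"
  shows "integrable lborel f"
proof -
  have "integrable lborel (\<lambda>x. indicator {-R..R} x *\<^sub>R f x)"
    by (rule borel_integrable_compact) (auto intro: continuous_on_subset[OF assms(1)])
  moreover have "(\<lambda>x. indicator {-R..R} x *\<^sub>R f x) = f"
    using assms(2) by (force simp: indicator_def)
  ultimately show ?thesis by simp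
qed

lemma l2_rel_test_function:
  assumes \<phi>: "test_function \<phi>"
  shows "l2_rel \<phi> \<phi>"
proof -
  obtain R where R: "\<And>x. R < \<bar>x\<bar> \<Longrightarrow> \<phi> x = 0" using \<phi> by (auto simp: test_function_def)
  have "integrable lborel (\<lambda>x. (\<phi> x)\<^sup>2)"
    by (rule integrable_continuous_compact_support[of _ R])
      (use R in \<open>auto intro!: continuous_intros test_function_continuous_on[OF \<phi>]\<close>)
  moreover have "\<phi> \<in> borel_measurable lborel"
    using test_function_continuous_on[OF \<phi>] by (simp add: borel_measurable_continuous_onI)
  ultimately show ?thesis by (simp add: l2_rel_def square_integrable_def)
qed

lemma abs_l2_affine_combination:
  assumes "test_function \<phi>" "test_function \<psi>"
  shows "abs_l2 (\<lambda>x. a * \<phi> x + \<psi> x) = a *\<^sub>R abs_l2 \<phi> + abs_l2 \<psi>"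
proof -
  note rel = l2_rel_test_function[OF assms(1)] l2_rel_test_function[OF assms(2)]
  have "l2_rel (\<lambda>x. a * \<phi> x) (\<lambda>x. a * \<phi> x)"
    using rel(1) by (simp add: l2_rel_def square_integrable_scale)
  then show ?thesis by (simp add: scaleR_l2.abs_eq[OF rel(1)] plus_l2.abs_eq[OF _ rel(2)])
qed

text \<open>The product \<open>\<phi> \<psi>\<close> has compact support, so its derivative integrates to 0.\<close>

lemma inner_test_functions_by_parts:
  assumes \<phi>: "test_function \<phi>" and \<psi>: "test_function \<psi>"
  shows "inner (abs_l2 (deriv \<phi>)) (abs_l2 \<psi>) = - inner (abs_l2 \<phi>) (abs_l2 (deriv \<psi>))"
proof -
  note [continuous_intros] = test_function_continuous_on[OF \<phi>] test_function_continuous_on[OF \<psi>]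
    test_function_continuous_on[OF test_function_deriv[OF \<phi>]]
    test_function_continuous_on[OF test_function_deriv[OF \<psi>]]
  obtain R where R: "\<And>x. R < \<bar>x\<bar> \<Longrightarrow> \<phi> x = 0" "\<And>x. R < \<bar>x\<bar> \<Longrightarrow> deriv \<phi> x = 0"
  proof -
    obtain R1 R2 where "\<And>x. R1 < \<bar>x\<bar> \<Longrightarrow> \<phi> x = 0" "\<And>x. R2 < \<bar>x\<bar> \<Longrightarrow> deriv \<phi> x = 0"
      using \<phi> test_function_deriv[OF \<phi>] by (auto simp: test_function_def)
    then show ?thesis by (intro that[of "max R1 R2"]) auto
  qed
  define S where "S = \<bar>R\<bar> + 1"
  have S: "R < \<bar>S\<bar>" "R < \<bar>- S\<bar>" "- S \<le> S" by (auto simp: S_def)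
  define h where "h = (\<lambda>x. deriv \<phi> x * \<psi> x + \<phi> x * deriv \<psi> x)"
  have "(\<integral>x. indicator {-S..S} x *\<^sub>R h x \<partial>lborel) = \<phi> S * \<psi> S - \<phi> (-S) * \<psi> (-S)"
  proof (rule integral_FTC_Icc[OF S(3)])
    fix x
    have "((\<lambda>x. \<phi> x * \<psi> x) has_real_derivative h x) (at x)"
      using DERIV_mult[OF test_function_has_derivative[OF \<phi>] test_function_has_derivative[OF \<psi>]]
      by (simp add: h_def mult.commute)
    then show "((\<lambda>x. \<phi> x * \<psi> x) has_vector_derivative h x) (at x within {-S..S})"
      unfolding has_real_derivative_iff_has_vector_derivative[symmetric]
      by (rule has_field_derivative_at_within)
    show "continuous_on {-S..S} h" unfolding h_def
      by (rule continuous_on_subset[OF _ subset_UNIV]) (intro continuous_intros)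
  qed
  moreover have "(\<lambda>x. indicator {-S..S} x *\<^sub>R h x) = h"
  proof
    fix x
    show "indicator {-S..S} x *\<^sub>R h x = h x"
    proof (cases "R < \<bar>x\<bar>")
      case True
      then show ?thesis using R by (simp add: h_def)
    next
      case False
      then have "x \<in> {-S..S}" by (auto simp: S_def)
      then show ?thesis by simp
    qed
  qed
  ultimately have "(\<integral>x. h x \<partial>lborel) = 0" using R S by simp
  moreover have "integrable lborel (\<lambda>x. deriv \<phi> x * \<psi> x)" "integrable lborel (\<lambda>x. \<phi> x * deriv \<psi> x)"
    by (rule integrable_continuous_compact_support[of _ R]; use R in \<open>auto intro!: continuous_intros\<close>)+
  ultimately have "(\<integral>x. deriv \<phi> x * \<psi> x \<partial>lborel) = - (\<integral>x. \<phi> x * deriv \<psi> x \<partial>lborel)"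
    unfolding h_def by simp
  then show ?thesis
    using \<phi> \<psi> by (simp add: inner_l2.abs_eq l2_rel_test_function test_function_deriv)
qed

lemma norm_dilation:
  assumes \<phi>: "test_function \<phi>" and c: "0 < c"
  shows "(norm (abs_l2 (\<lambda>x. \<phi> (c * x))))\<^sup>2 = (norm (abs_l2 \<phi>))\<^sup>2 / c"
proof -
  have "(\<integral>x. (\<phi> x)\<^sup>2 \<partial>lborel) = c * (\<integral>x. (\<phi> (c * x))\<^sup>2 \<partial>lborel)"
    using lborel_integral_real_affine[of c "\<lambda>x. (\<phi> x)\<^sup>2" 0] c by simp
  then show ?thesis
    using c by (simp add: norm_l2_sq l2_rel_test_function test_function_dilation \<phi>)
qed

section \<open>Weak derivatives\<close>

text \<open>This form makes linearity and closedness of weak differentiation properties of the inner product.\<close>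

lemma weak_derivative_iff_inner:
  "weak_derivative k f g \<longleftrightarrow> (\<forall>\<phi>. test_function \<phi> \<longrightarrow>
     inner f (abs_l2 ((deriv ^^ k) \<phi>)) = (-1) ^ k * inner g (abs_l2 \<phi>))"
proof -
  have rep: "l2_rel (rep_l2 h) (rep_l2 h)" "h = abs_l2 (rep_l2 h)" for h
    using Quotient_rep_reflp[OF Quotient_l2] Quotient_abs_rep[OF Quotient_l2] by auto
  obtain F where F: "l2_rel F F" "f = abs_l2 F" using rep[of f] by blast
  obtain G where G: "l2_rel G G" "g = abs_l2 G" using rep[of g] by blast
  show ?thesis
    by (auto simp: F G weak_derivative.abs_eq inner_l2.abs_eq l2_rel_test_function
        test_function_iterated_deriv)
qed

lemma weak_derivative_inner:
  "weak_derivative k f g \<Longrightarrow> test_function \<phi> \<Longrightarrow>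
     inner f (abs_l2 ((deriv ^^ k) \<phi>)) = (-1) ^ k * inner g (abs_l2 \<phi>)"
  by (simp add: weak_derivative_iff_inner)

lemma weak_derivative_0: "weak_derivative 0 f f"
  by (simp add: weak_derivative_iff_inner)

lemma weak_derivative_zero: "weak_derivative k 0 0"
  by (simp add: weak_derivative_iff_inner)

lemma weak_derivative_test_function:
  assumes "test_function \<phi>"
  shows "weak_derivative k (abs_l2 \<phi>) (abs_l2 ((deriv ^^ k) \<phi>))"
  unfolding weak_derivative_iff_inner
proof (intro allI impI)
  fix \<psi> assume "test_function \<psi>"
  then show "inner (abs_l2 \<phi>) (abs_l2 ((deriv ^^ k) \<psi>)) = (-1) ^ k * inner (abs_l2 ((deriv ^^ k) \<phi>)) (abs_l2 \<psi>)"
  proof (induction k arbitrary: \<psi>)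
    case (Suc k)
    have "inner (abs_l2 \<phi>) (abs_l2 ((deriv ^^ Suc k) \<psi>)) =
        (-1) ^ k * inner (abs_l2 ((deriv ^^ k) \<phi>)) (abs_l2 (deriv \<psi>))"
      using Suc.IH[OF test_function_deriv[OF Suc.prems]] by (simp only: funpow_Suc_right o_apply)
    then show ?case
      using inner_test_functions_by_parts[OF test_function_iterated_deriv[OF assms] Suc.prems, of k]
      by simp
  qed simp
qed

lemma weak_derivative_2:
  assumes "weak_derivative 1 f f1" "weak_derivative 2 f g"
  shows "weak_derivative 1 f1 g"
  unfolding weak_derivative_iff_inner
proof (intro allI impI)
  fix \<phi> assume \<phi>: "test_function \<phi>"
  show "inner f1 (abs_l2 ((deriv ^^ 1) \<phi>)) = (-1) ^ 1 * inner g (abs_l2 \<phi>)"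
    using weak_derivative_inner[OF assms(1) test_function_deriv[OF \<phi>]]
      weak_derivative_inner[OF assms(2) \<phi>]
    by (simp add: numeral_2_eq_2)
qed

lemma laplacian_iff:
  "(f, g) \<in> laplacian \<longleftrightarrow> (\<exists>f1. weak_derivative 1 f f1) \<and> weak_derivative 2 f g"
proof -
  have "j = 0 \<or> j = 1 \<or> j = 2" if "j \<le> 2" for j :: nat using that by linarith
  then show ?thesis
    using weak_derivative_0 by (fastforce simp: laplacian_def sobolev_H_def)
qed

lemma test_function_laplacian:
  "test_function \<phi> \<Longrightarrow> (abs_l2 \<phi>, abs_l2 ((deriv ^^ 2) \<phi>)) \<in> laplacian"
  using weak_derivative_test_function laplacian_iff by blast

section \<open>Consequences of the generation hypothesis\<close>

lemma generator_drift_iff: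
  assumes "is_exp_semigroup (drift_operator p) S"
  shows "(f, h) \<in> generator S \<longleftrightarrow> (f, h - p *\<^sub>R f) \<in> laplacian"
  using assms by (force simp: is_exp_semigroup_def drift_operator_def algebra_simps)

text \<open>If \<open>h\<close> is orthogonal to all test functions, then \<open>h\<close> is a weak second derivative of 0, so the generator
  contains \<open>(0, h)\<close>. The difference quotient of the orbit of 0 vanishes, so its limit \<open>h\<close> is 0.\<close>

lemma test_functions_total:
  assumes gen: "is_exp_semigroup (drift_operator p) S"
    and orth: "\<And>\<phi>. test_function \<phi> \<Longrightarrow> inner h (abs_l2 \<phi>) = 0"
  shows "h = 0"
proof -
  have S: "c0_semigroup S" using gen by (simp add: is_exp_semigroup_def)
  have "weak_derivative 1 0 0" "weak_derivative 2 0 h"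
    using orth weak_derivative_zero by (auto simp: weak_derivative_iff_inner)
  then have "(0, h) \<in> generator S"
    by (auto simp: generator_drift_iff[OF gen] laplacian_iff)
  then have "((\<lambda>t. (S t 0 - 0) /\<^sub>R t) \<longlongrightarrow> h) (at_right 0)" by (simp add: generator_def)
  moreover have "\<forall>\<^sub>F t in at_right 0. (S t 0 - 0) /\<^sub>R t = 0"
    unfolding eventually_at_filter
    by (intro always_eventually)
      (simp add: linear_0[OF bounded_linear.linear[OF c0_semigroupD(1)[OF S]]])
  ultimately have "((\<lambda>_. 0) \<longlongrightarrow> h) (at_right (0::real))" by (rule Lim_transform_eventually)
  then show ?thesis by (simp add: tendsto_const_iff)
qed

text \<open>An eigenvector for \<open>r\<close> would be multiplied by \<open>e\<^bsup>p + r\<^esup>\<close> under \<open>S 1\<close>, more than the norm of \<open>S 1\<close> allows.\<close>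

lemma laplacian_no_large_eigenvalue:
  assumes gen: "is_exp_semigroup (drift_operator p) S"
    and large: "onorm (S 1) < exp (p + r)" and f: "(f, r *\<^sub>R f) \<in> laplacian"
  shows "f = 0"
proof (rule ccontr)
  assume "f \<noteq> 0"
  have S: "c0_semigroup S" using gen by (simp add: is_exp_semigroup_def)
  have "(f, (p + r) *\<^sub>R f) \<in> generator S"
    using f by (simp add: generator_drift_iff[OF gen] algebra_simps)
  then have "S 1 f = exp (p + r) *\<^sub>R f"
    using generator_eigenvector_orbit[OF S, of f "p + r" 1] by simp
  then have "exp (p + r) * norm f \<le> onorm (S 1) * norm f"
    using onorm[OF c0_semigroupD(1)[OF S, of 1], of f] by simp
  then show False using large \<open>f \<noteq> 0\<close> by simp
qed

text \<open>The pairs \<open>(s u, u')\<close> embed the first Sobolev space into \<open>L\<^sup>2 \<times> L\<^sup>2\<close>, with inner product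
  \<open>s\<^sup>2 \<langle>u, v\<rangle> + \<langle>u', v'\<rangle>\<close>. Let \<open>M\<close> be the image of the test functions. The component \<open>(f, f1)\<close> of \<open>(s u, a)\<close>
  orthogonal to \<open>M\<close> satisfies \<open>f'' = s\<^sup>2 f\<close> weakly, so it vanishes when \<open>s\<close> is large. Therefore \<open>(s u, a)\<close>
  lies in the closure of \<open>M\<close>, and the identity, valid for test functions by definition of \<open>b\<close>, passes to
  the limit.\<close>

lemma weak_derivative_by_parts:
  assumes gen: "is_exp_semigroup (drift_operator p) S"
    and u: "weak_derivative 1 u a" and v: "weak_derivative 1 v b"
  shows "inner a v = - inner u b"
proof -
  \<comment> \<open>The weight is written as a square, because its square root appears in the embedding.\<close>
  obtain s where s: "0 < s" and large: "onorm (S 1) < exp (p + s * s)"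
  proof -
    define N where "N = \<bar>onorm (S 1)\<bar> + 1"
    \<comment> \<open>Large enough for \<open>p + r \<ge> ln N\<close>.\<close>
    define r where "r = \<bar>ln N - p\<bar> + 1"
    have "onorm (S 1) < exp (ln N)" by (simp add: N_def)
    also have "\<dots> \<le> exp (p + sqrt r * sqrt r)" by (simp add: r_def)
    finally show ?thesis by (intro that[of "sqrt r"]) (auto simp: r_def)
  qed
  define M where "M = {(s *\<^sub>R abs_l2 \<phi>, abs_l2 (deriv \<phi>)) | \<phi>. test_function \<phi>}"
  have MI: "(s *\<^sub>R abs_l2 \<phi>, abs_l2 (deriv \<phi>)) \<in> M" if "test_function \<phi>" for \<phi>
    using that by (auto simp: M_def)
  have comb: "c *\<^sub>R z + z' \<in> M" if z: "z \<in> M" "z' \<in> M" for c z z'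
  proof -
    obtain \<phi> \<psi> where *: "test_function \<phi>" "z = (s *\<^sub>R abs_l2 \<phi>, abs_l2 (deriv \<phi>))"
      "test_function \<psi>" "z' = (s *\<^sub>R abs_l2 \<psi>, abs_l2 (deriv \<psi>))"
      using z by (auto simp: M_def)
    have "deriv (\<lambda>x. c * \<phi> x + \<psi> x) = (\<lambda>x. c * deriv \<phi> x + deriv \<psi> x)"
      using iterated_deriv_affine_combination[OF *(1,3), of 1 c] by simp
    then have "c *\<^sub>R z + z' = (s *\<^sub>R abs_l2 (\<lambda>x. c * \<phi> x + \<psi> x), abs_l2 (deriv (\<lambda>x. c * \<phi> x + \<psi> x)))"
      using * by (simp add: abs_l2_affine_combination test_function_deriv scaleR_add_right mult.commute)
    then show ?thesis using MI[OF test_function_affine_combination[OF *(1,3)]] by simp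
  qed
  have zero: "0 \<in> M"
  proof -
    have "deriv (\<lambda>x::real. 0::real) = (\<lambda>x. 0)" by auto
    then show ?thesis using MI[OF test_function_zero] by (simp add: zero_prod_def zero_l2.abs_eq[symmetric])
  qed
  have "subspace M"
    unfolding subspace_def using comb[of _ _ 1] comb[OF _ zero] zero by auto
  then have "subspace (closure M)" by (rule subspace_closure)
  then obtain m1 m2 where m: "(m1, m2) \<in> closure M"
    and orth: "\<And>z. z \<in> closure M \<Longrightarrow> inner ((s *\<^sub>R u, a) - (m1, m2)) z = 0"
    using orthogonal_projection_exists[OF _ closed_closure] by (metis surj_pair)
  define f where "f = s *\<^sub>R u - m1"
  define f1 where "f1 = a - m2"
  have orth_test: "s * inner f (abs_l2 \<phi>) = - inner f1 (abs_l2 (deriv \<phi>))"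
    if "test_function \<phi>" for \<phi>
    using orth[of "(s *\<^sub>R abs_l2 \<phi>, abs_l2 (deriv \<phi>))"] MI[OF that] closure_subset[of M]
    by (auto simp: f_def f1_def inner_prod_def)
  \<comment> \<open>Weak differentiability with derivative rescaled by \<open>s\<close> is a closed condition on pairs.\<close>
  have "inner m1 (abs_l2 (deriv \<psi>)) = - (s * inner m2 (abs_l2 \<psi>))" if \<psi>: "test_function \<psi>" for \<psi>
  proof -
    have "closed {z. inner (fst z) (abs_l2 (deriv \<psi>)) = - (s * inner (snd z) (abs_l2 \<psi>))}"
      by (intro closed_Collect_eq continuous_intros)
    then have "closure M \<subseteq> {z. inner (fst z) (abs_l2 (deriv \<psi>)) = - (s * inner (snd z) (abs_l2 \<psi>))}"
      by (rule closure_minimal[rotated]) (use \<psi> in \<open>auto simp: M_def inner_test_functions_by_parts\<close>)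
    then show ?thesis using m by auto
  qed
  then have f1: "weak_derivative 1 f (s *\<^sub>R f1)"
    using u by (auto simp: weak_derivative_iff_inner f_def f1_def inner_diff_left algebra_simps)
  have "weak_derivative 2 f ((s * s) *\<^sub>R f)"
    unfolding weak_derivative_iff_inner
  proof (intro allI impI)
    fix \<phi> assume \<phi>: "test_function \<phi>"
    show "inner f (abs_l2 ((deriv ^^ 2) \<phi>)) = (-1)\<^sup>2 * inner ((s * s) *\<^sub>R f) (abs_l2 \<phi>)"
      using weak_derivative_inner[OF f1 test_function_deriv[OF \<phi>]] orth_test[OF \<phi>]
      by (simp add: numeral_2_eq_2 mult.assoc)
  qed
  then have f0: "f = 0"
    using f1 by (intro laplacian_no_large_eigenvalue[OF gen large]) (auto simp: laplacian_iff)
  have "f1 = 0"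
  proof (rule test_functions_total[OF gen])
    fix \<phi> assume "test_function \<phi>"
    then show "inner f1 (abs_l2 \<phi>) = 0"
      using weak_derivative_inner[OF f1] f0 s by simp
  qed
  then have in_closure: "(s *\<^sub>R u, a) \<in> closure M" using m f0 by (simp add: f_def f1_def)
  have "closed {z. s * inner (snd z) v = - inner (fst z) b}"
    by (intro closed_Collect_eq continuous_intros)
  then have "closure M \<subseteq> {z. s * inner (snd z) v = - inner (fst z) b}"
  proof (rule closure_minimal[rotated], safe)
    fix z assume "z \<in> M"
    then obtain \<phi> where "test_function \<phi>" "z = (s *\<^sub>R abs_l2 \<phi>, abs_l2 (deriv \<phi>))"
      by (auto simp: M_def)
    then show "s * inner (snd z) v = - inner (fst z) b"
      using weak_derivative_inner[OF v, of \<phi>] by (simp add: inner_commute)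
  qed
  then have "s * inner a v = s * (- inner u b)" using in_closure by auto
  then show ?thesis by (rule mult_left_cancel[THEN iffD1, rotated]) (use s in simp)
qed

text \<open>Two integrations by parts: both sides are minus the inner product of the weak first derivatives.\<close>

lemma laplacian_symmetric:
  assumes gen: "is_exp_semigroup (drift_operator p) S"
    and "(f, g) \<in> laplacian" "(f', g') \<in> laplacian"
  shows "inner g f' = inner f g'"
proof -
  obtain f1 where f1: "weak_derivative 1 f f1" "weak_derivative 1 f1 g"
    using assms(2) weak_derivative_2 by (auto simp: laplacian_iff)
  obtain f1' where f1': "weak_derivative 1 f' f1'" "weak_derivative 1 f1' g'"
    using assms(3) weak_derivative_2 by (auto simp: laplacian_iff)
  show ?thesis
    using weak_derivative_by_parts[OF gen f1(2) f1'(1)] weak_derivative_by_parts[OF gen f1(1) f1'(2)]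
    by simp
qed

text \<open>Integration by parts gives \<open>\<langle>f'', f\<rangle> = - \<parallel>f'\<parallel>\<^sup>2\<close>.\<close>

lemma laplacian_nonpositive:
  assumes gen: "is_exp_semigroup (drift_operator p) S" and "(f, g) \<in> laplacian"
  shows "inner g f \<le> 0"
proof -
  obtain f1 where "weak_derivative 1 f f1" "weak_derivative 1 f1 g"
    using assms(2) weak_derivative_2 by (auto simp: laplacian_iff)
  then show ?thesis using weak_derivative_by_parts[OF gen, of f1 g f f1] by simp
qed

text \<open>The domain contains the test functions, whose orthogonal complement is trivial.\<close>

lemma drift_domain_dense:
  assumes gen: "is_exp_semigroup (drift_operator p) S"
  shows "closure (Domain (generator S)) = UNIV"
proof -
  define M where "M = abs_l2 ` Collect test_function"
  have comb: "c *\<^sub>R z + z' \<in> M" if "z \<in> M" "z' \<in> M" for c z z'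
    using that test_function_affine_combination
    by (auto simp: M_def abs_l2_affine_combination[symmetric])
  have zero: "0 \<in> M" using test_function_zero by (force simp: M_def zero_l2_def)
  have "subspace M"
    unfolding subspace_def using comb[of _ _ 1] comb[OF _ zero] zero by auto
  then have "closure M = UNIV"
    by (rule dense_if_orthogonal_complement_trivial)
      (rule test_functions_total[OF gen], auto simp: M_def)
  moreover have "M \<subseteq> Domain (generator S)"
  proof
    fix f assume "f \<in> M"
    then obtain g where "(f, g) \<in> laplacian" using test_function_laplacian by (auto simp: M_def)
    then have "(f, p *\<^sub>R f + g) \<in> generator S" by (simp add: generator_drift_iff[OF gen])
    then show "f \<in> Domain (generator S)" by blast
  qed
  ultimately show ?thesis using closure_mono by blast
qed

text \<open>Zero belongs to the approximate point spectrum: under \<open>\<phi> (x) \<mapsto> \<phi> (c x)\<close> the norm of the function and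
  that of its second derivative scale by \<open>c\<^bsup>-1/2\<^esup>\<close> and \<open>c\<^sup>2 c\<^bsup>-1/2\<^esup>\<close>.\<close>

lemma laplacian_approximate_kernel:
  assumes gen: "is_exp_semigroup (drift_operator p) S" and e: "0 < e"
  obtains f g where "(f, g) \<in> laplacian" "f \<noteq> 0" "norm g \<le> e * norm f"
proof -
  obtain \<phi> where \<phi>: "test_function \<phi>" "abs_l2 \<phi> \<noteq> 0"
  proof (rule ccontr)
    \<comment> \<open>If all test functions vanished, the indicator of an interval would be orthogonal to them, hence 0.\<close>
    assume "\<not> thesis"
    then have trivial: "\<And>\<phi>. test_function \<phi> \<Longrightarrow> abs_l2 \<phi> = 0" using that by blast
    define h where "h = (\<lambda>x::real. indicator {0..1} x :: real)"
    have h2: "(\<lambda>x. (h x)\<^sup>2) = h" by (auto simp: h_def indicator_def)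
    have h: "l2_rel h h"
      unfolding l2_rel_def square_integrable_def h2 by (simp add: h_def)
    have "abs_l2 h = 0" by (rule test_functions_total[OF gen]) (simp add: trivial)
    then show False using norm_l2_sq[OF h] by (simp add: h2) (simp add: h_def)
  qed
  define n2 where "n2 = norm (abs_l2 ((deriv ^^ 2) \<phi>))"
  \<comment> \<open>This makes \<open>c\<^sup>2 \<parallel>\<phi>\<parallel> \<le> e \<parallel>\<phi>\<parallel>\<close> also when \<open>\<phi> = 0\<close>.\<close>
  define c where "c = sqrt (e * norm (abs_l2 \<phi>) / (n2 + 1))"
  have n2: "0 \<le> n2" by (simp add: n2_def)
  have c: "0 < c" using e \<phi>(2) n2 by (simp add: c_def)
  have c2: "c\<^sup>2 * n2 \<le> e * norm (abs_l2 \<phi>)"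
  proof -
    have "c\<^sup>2 = e * norm (abs_l2 \<phi>) / (n2 + 1)" using e n2 by (simp add: c_def)
    then have "c\<^sup>2 * (n2 + 1) = e * norm (abs_l2 \<phi>)" using n2 by simp
    moreover have "c\<^sup>2 * n2 \<le> c\<^sup>2 * (n2 + 1)" by (intro mult_left_mono) auto
    ultimately show ?thesis by simp
  qed
  define \<psi> where "\<psi> = (\<lambda>x. \<phi> (c * x))"
  define \<eta> where "\<eta> = (\<lambda>x. (deriv ^^ 2) \<phi> (c * x))"
  have t: "test_function \<psi>" unfolding \<psi>_def by (rule test_function_dilation[OF \<phi>(1) c])
  have t2: "test_function \<eta>"
    unfolding \<eta>_def by (rule test_function_dilation[OF test_function_iterated_deriv[OF \<phi>(1)] c])
  have "abs_l2 ((deriv ^^ 2) \<psi>) = c\<^sup>2 *\<^sub>R abs_l2 \<eta>"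
    unfolding \<psi>_def iterated_deriv_dilation[OF \<phi>(1)]
    using scaleR_l2.abs_eq[OF l2_rel_test_function[OF t2]] by (simp add: \<eta>_def)
  then have "(norm (abs_l2 ((deriv ^^ 2) \<psi>)))\<^sup>2 = (c\<^sup>2 * n2)\<^sup>2 / c"
    using norm_dilation[OF test_function_iterated_deriv[OF \<phi>(1)] c, of 2]
    by (simp add: \<eta>_def n2_def power_mult_distrib)
  also have "\<dots> \<le> (e * norm (abs_l2 \<phi>))\<^sup>2 / c"
    using c c2 n2 by (intro divide_right_mono power_mono) auto
  also have "\<dots> = (e * norm (abs_l2 \<psi>))\<^sup>2"
    using norm_dilation[OF \<phi>(1) c] by (simp add: \<psi>_def power_mult_distrib)
  finally have "norm (abs_l2 ((deriv ^^ 2) \<psi>)) \<le> e * norm (abs_l2 \<psi>)"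
    by (rule power2_le_imp_le) (use e in simp)
  moreover have "abs_l2 \<psi> \<noteq> 0"
    using norm_dilation[OF \<phi>(1) c] \<phi>(2) c by (auto simp: \<psi>_def)
  ultimately show ?thesis using test_function_laplacian[OF t] by (intro that)
qed

text \<open>Apply \<open>V\<^sub>\<infinity> (A f) = - f / 2\<close> to approximate kernel elements of the Laplacian, for which
  \<open>\<parallel>A f\<parallel> \<le> (\<bar>p\<bar> + d) \<parallel>f\<parallel>\<close> with \<open>d\<close> arbitrarily small.\<close>

lemma asymptotic_covariance_onorm_ge:
  assumes gen: "is_exp_semigroup (drift_operator p) S" and p: "p < 0"
  shows "onorm (asymptotic_covariance 1 id id S) \<ge> 1 / (2 * \<bar>p\<bar>)"
proof -
  have S: "c0_semigroup S" using gen by (simp add: is_exp_semigroup_def)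
  note dense = drift_domain_dense[OF gen]
  have self_adj: "inner (S t x) y = inner x (S t y)" if "0 \<le> t" for t x y
  proof (rule symmetric_generator_self_adjoint[OF S dense _ that])
    fix f g f' g' assume "(f, g) \<in> generator S" "(f', g') \<in> generator S"
    then show "inner g f' = inner f g'"
      using laplacian_symmetric[OF gen, of f "g - p *\<^sub>R f" f' "g' - p *\<^sub>R f'"]
      by (simp add: generator_drift_iff[OF gen] inner_simps)
  qed
  have decay: "norm (S t x) \<le> exp (p * t) * norm x" if "0 \<le> t" for t x
  proof (rule dissipative_generator_decay[OF S dense _ that])
    fix f g assume "(f, g) \<in> generator S"
    then show "inner g f \<le> p * inner f f"
      using laplacian_nonpositive[OF gen, of f "g - p *\<^sub>R f"]
      by (simp add: generator_drift_iff[OF gen] inner_simps)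
  qed
  define V where "V = asymptotic_covariance 1 id id S"
  have V: "bounded_linear V"
    unfolding V_def by (rule asymptotic_covariance_bounded_linear[OF S self_adj decay p])
  have "1 \<le> 2 * \<bar>p\<bar> * onorm V + e" if "0 < e" for e
  proof -
    \<comment> \<open>The summand 1 keeps the denominator positive; it absorbs the error \<open>2 \<parallel>V\<parallel> d\<close> into \<open>e\<close>.\<close>
    define d where "d = e / (2 * onorm V + 1)"
    have nV: "0 \<le> onorm V" by (rule onorm_pos_le[OF V])
    have d: "0 < d" using that nV by (simp add: d_def)
    obtain f g where fg: "(f, g) \<in> laplacian" "f \<noteq> 0" "norm g \<le> d * norm f"
      using laplacian_approximate_kernel[OF gen d] .
    have "(f, p *\<^sub>R f + g) \<in> generator S" using fg(1) by (simp add: generator_drift_iff[OF gen])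
    then have "V (p *\<^sub>R f + g) = - (1/2) *\<^sub>R f"
      unfolding V_def using asymptotic_covariance_generator[OF S self_adj decay p] by blast
    then have "norm f / 2 \<le> onorm V * norm (p *\<^sub>R f + g)"
      using onorm[OF V, of "p *\<^sub>R f + g"] by simp
    also have "\<dots> \<le> onorm V * ((\<bar>p\<bar> + d) * norm f)"
    proof (intro mult_left_mono nV)
      show "norm (p *\<^sub>R f + g) \<le> (\<bar>p\<bar> + d) * norm f"
        using norm_triangle_ineq[of "p *\<^sub>R f" g] fg(3) by (simp add: algebra_simps)
    qed
    finally have "1 * norm f \<le> (2 * onorm V * (\<bar>p\<bar> + d)) * norm f" by simp
    then have "1 \<le> 2 * onorm V * (\<bar>p\<bar> + d)" using fg(2) by (simp only: mult_le_cancel_right) simp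
    also have "\<dots> = 2 * \<bar>p\<bar> * onorm V + 2 * onorm V * d" by (simp add: algebra_simps)
    also have "2 * onorm V * d \<le> (2 * onorm V + 1) * d" using d by (intro mult_right_mono) auto
    also have "(2 * onorm V + 1) * d = e" using nV by (simp add: d_def)
    finally show ?thesis by simp
  qed
  then have "1 \<le> 2 * \<bar>p\<bar> * onorm V" by (rule field_le_epsilon)
  then show ?thesis using p by (simp add: V_def field_simps)
qed

theorem theorem4p1:
  fixes S :: "real \<Rightarrow> real \<Rightarrow> l2 \<Rightarrow> l2"
  assumes "\<And>p. p < 0 \<Longrightarrow> is_exp_semigroup (drift_operator p) (S p)"
  shows "filterlim (\<lambda>p. onorm (asymptotic_covariance 1 (id :: l2 \<Rightarrow> l2) id (S p))) at_top (at_left 0)"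
proof (rule filterlim_at_top_mono)
  have "filterlim (\<lambda>p::real. - (2 * p)) (at_right 0) (at_left 0)"
    unfolding filterlim_at
    by (auto simp: eventually_at_filter intro!: tendsto_eq_intros always_eventually)
  then show "filterlim (\<lambda>p::real. inverse (- (2 * p))) at_top (at_left 0)"
    by (rule filterlim_compose[OF filterlim_inverse_at_top_right])
  show "\<forall>\<^sub>F p in at_left 0. inverse (- (2 * p)) \<le> onorm (asymptotic_covariance 1 id id (S p))"
    unfolding eventually_at_filter
    using asymptotic_covariance_onorm_ge[OF assms]
    by (intro always_eventually) (auto simp: inverse_eq_divide)
qed

end
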